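(* Let $G$ and $G'$ be edge-colored loop-signed graphs with $n$ vertices and $k$ colors, with adjacency matrices $(A^c_G)_{c=1}^k$ and $(A^c_{G'})_{c=1}^k$, respectively. If $\mathrm{tr}(A^c_G)=\mathrm{tr}(A^c_{G'})$ for every $c\in\{1,2,\ldots,k\}$, then the following are equivalent: (1) $G$ and $G'$ are transplantable; (2) $G$ and $G'$ are cycle equivalent; (3) the vertex-colored directed line graphs $L^{\mathrm{vc}}(G)$ and $L^{\mathrm{vc}}(G')$ are transplantable; (4) $L^{\mathrm{vc}}(G)$ and $L^{\mathrm{vc}}(G')$ are cycle equivalent; (5) the edge-colored directed line graphs $L^{\mathrm{ec}}(G)$ and $L^{\mathrm{ec}}(G')$ are transplantable; (6) $L^{\mathrm{ec}}(G)$ and $L^{\mathrm{ec}}(G')$ are cycle equivalent. If any of the conditions (1)–(6) holds, then there exists an invertible matrix that is a transplantation matrix for both (3) and (5) and that is the direct sum of square matrices of sizes $\big(\mathrm{tr}(I_n+A^c_G)/2\big)_{c=1}^k$ (with respect to the ordering of line graph vertices by color).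
   Context: **Edge-colored loop-signed graphs.** An edge-colored loop-signed graph $G$ with $n$ vertices and $k$ colors is a finite graph with vertex set $\{1,\ldots,n\}$ and edges colored by $\{1,\ldots,k\}$ such that every vertex has exactly one incident edge of each color. This edge is either a link (an edge to a different vertex) or a signed loop, which is an $N$-loop or a $D$-loop. Parallel links of different colors, and several loops of different colors at one vertex, are allowed. The graph is determined by its symmetric $n\times n$ adjacency matrices $(A^c_G)_{c=1}^k$, where $[A^c_G]_{v\tilde v}=1$ if $v\neq\tilde v$ and there is a $c$-colored link between $v$ and $\tilde v$; $[A^c_G]_{vv}=1$ if there is a $c$-colored $N$-loop at $v$; $[A^c_G]_{vv}=-1$ if there is a $c$-colored $D$-loop at $v$; all other entries are $0$. The number $\mathrm{tr}(I_n+A^c_G)/2$ is the number of $c$-colored links and $N$-loops of $G$. **Transplantable and cycle equivalent.** Consider two (edge- or vertex-)colored graphs given by tuples, indexed by the same finite set $\mathcal{C}$ of colors, of $m\times m$ adjacency matrices $(A^c)_{c\in\mathcal{C}}$ and $(A'^c)_{c\in\mathcal{C}}$. They are *transplantable* if there is an invertible $T\in\mathbb{R}^{m\times m}$ (a transplantation matrix) with $A^c=TA'^cT^{-1}$ for every $c\in\mathcal{C}$. They are *cycle equivalent* if $\mathrm{tr}(A^{c_1}A^{c_2}\cdots A^{c_l})=\mathrm{tr}(A'^{c_1}A'^{c_2}\cdots A'^{c_l})$ for every finite sequence of colors $c_1,\ldots,c_l\in\mathcal{C}$. **Line graphs.** Let $G^*$ be the graph obtained from $G$ by removing all $D$-loops,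 and let $n_L=\sum_{c=1}^k \mathrm{tr}(I_n+A^c_G)/2$ be its number of edges. Number the edges of $G^*$ by $1,\ldots,n_L$ ordered by color: first all edges of color $1$, then all of color $2$, and so on. (When $\mathrm{tr}(A^c_G)=\mathrm{tr}(A^c_{G'})$ for all $c$, the numbers $n_L$ and the color blocks agree for $G$ and $G'$.) The vertex-colored directed line graph $L^{\mathrm{vc}}(G)$ has one $c$-colored vertex for each $c$-colored edge of $G^*$, color set $\{1,\ldots,k\}$, and is defined by its $n_L\times n_L$ adjacency matrices $(A^c_{L^{\mathrm{vc}}(G)})_{c=1}^k$: $[A^c_{L^{\mathrm{vc}}(G)}]_{e\tilde e}=2$ if edge $e$ of $G^*$ is $c$-colored and shares all of its vertices with edge $\tilde e\neq e$; $[A^c_{L^{\mathrm{vc}}(G)}]_{e\tilde e}=1$ if edge $e$ is a $c$-colored link and shares (exactly) one vertex with edge $\tilde e\neq e$; all other entries are $0$. (The only vertex of a loop is the vertex to which it is attached.) The edge-colored directed line graph $L^{\mathrm{ec}}(G)$ has $n_L$ vertices, color set $\{\{c,\tilde c\}\mid 1\le c<\tilde c\le k\}$, and is defined by the $n_L\times n_L$ adjacency matrices $[A^{\{c,\tilde c\}}_{L^{\mathrm{ec}}(G)}]_{e\tilde e}=[A^c_{L^{\mathrm{vc}}(G)}]_{e\tilde e}+[A^{\tilde c}_{L^{\mathrm{vc}}(G)}]_{e\tilde e}$ if the set of colors of the edges $e$ and $\tilde e$ of $G^*$ is $\{c,\tilde c\}$, and $0$ otherwise. *)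

theory Defs
  imports Complex_Main "Jordan_Normal_Form.Matrix"
begin

text \<open>Vertices are \<open>0, \<dots>, n - 1\<close>, to match the indices of the library's matrices; colors are
  \<open>1, \<dots>, k\<close>. A graph is the set of its colored edges, and the argument of \<open>Link\<close> is the
  unordered pair of end points.\<close>

datatype edge = Link "nat set" | N_loop nat | D_loop nat

type_synonym colored_edge = "nat \<times> edge"
type_synonym colored_graph = "colored_edge set"

fun ends :: "edge \<Rightarrow> nat set" where
  "ends (Link S) = S"
| "ends (N_loop v) = {v}"
| "ends (D_loop v) = {v}"

fun is_link :: "edge \<Rightarrow> bool" where
  "is_link (Link S) \<longleftrightarrow> True"
| "is_link (N_loop v) \<longleftrightarrow> False"
| "is_link (D_loop v) \<longleftrightarrow> False"

fun is_D_loop :: "edge \<Rightarrow> bool" where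
  "is_D_loop (Link S) \<longleftrightarrow> False"
| "is_D_loop (N_loop v) \<longleftrightarrow> False"
| "is_D_loop (D_loop v) \<longleftrightarrow> True"

definition edge_on :: "nat \<Rightarrow> edge \<Rightarrow> bool" where
  "edge_on n e \<longleftrightarrow> ends e \<subseteq> {..<n} \<and> (is_link e \<longrightarrow> card (ends e) = 2)"

definition loop_signed_graph :: "nat \<Rightarrow> nat \<Rightarrow> colored_graph \<Rightarrow> bool" where
  "loop_signed_graph n k G \<longleftrightarrow>
     G \<subseteq> {1..k} \<times> {e. edge_on n e} \<and>
     (\<forall>c\<in>{1..k}. \<forall>v<n. \<exists>!e. (c, e) \<in> G \<and> v \<in> ends e)"

definition adj :: "nat \<Rightarrow> colored_graph \<Rightarrow> nat \<Rightarrow> real mat" where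
  "adj n G c = mat n n (\<lambda>(v, w).
     if v \<noteq> w \<and> (c, Link {v, w}) \<in> G then 1
     else if v = w \<and> (c, N_loop v) \<in> G then 1
     else if v = w \<and> (c, D_loop v) \<in> G then -1
     else 0)"

definition mat_trace :: "real mat \<Rightarrow> real" where
  "mat_trace A = (\<Sum>i<dim_row A. A $$ (i, i))"

text \<open>Below, \<open>A\<close> and \<open>A'\<close> are families of \<open>m \<times> m\<close> matrices indexed by the color set \<open>C\<close>;
  \<open>S\<close> is the inverse of \<open>T\<close>.\<close>

definition transplantation_matrix ::
    "nat \<Rightarrow> 'c set \<Rightarrow> ('c \<Rightarrow> real mat) \<Rightarrow> ('c \<Rightarrow> real mat) \<Rightarrow> real mat \<Rightarrow> bool" where
  "transplantation_matrix m C A A' T \<longleftrightarrow>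
     T \<in> carrier_mat m m \<and>
     (\<exists>S\<in>carrier_mat m m. inverts_mat T S \<and> inverts_mat S T \<and> (\<forall>c\<in>C. A c = T * A' c * S))"

definition transplantable ::
    "nat \<Rightarrow> 'c set \<Rightarrow> ('c \<Rightarrow> real mat) \<Rightarrow> ('c \<Rightarrow> real mat) \<Rightarrow> bool" where
  "transplantable m C A A' \<longleftrightarrow> (\<exists>T. transplantation_matrix m C A A' T)"

definition mat_word :: "nat \<Rightarrow> ('c \<Rightarrow> real mat) \<Rightarrow> 'c list \<Rightarrow> real mat" where
  "mat_word m A cs = foldr (\<lambda>c M. A c * M) cs (1\<^sub>m m)"

definition cycle_equivalent ::
    "nat \<Rightarrow> 'c set \<Rightarrow> ('c \<Rightarrow> real mat) \<Rightarrow> ('c \<Rightarrow> real mat) \<Rightarrow> bool" where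
  "cycle_equivalent m C A A' \<longleftrightarrow>
     (\<forall>cs. set cs \<subseteq> C \<longrightarrow> mat_trace (mat_word m A cs) = mat_trace (mat_word m A' cs))"

text \<open>A numbering, ordered by color, of the edges other than D-loops. Its length is the number
  of vertices of the line graphs.\<close>

definition edge_numbering :: "colored_graph \<Rightarrow> colored_edge list \<Rightarrow> bool" where
  "edge_numbering G es \<longleftrightarrow>
     distinct es \<and> set es = {(c, e). (c, e) \<in> G \<and> \<not> is_D_loop e} \<and> sorted (map fst es)"

definition vc_line_adj :: "colored_edge list \<Rightarrow> nat \<Rightarrow> real mat" where
  "vc_line_adj es c = mat (length es) (length es) (\<lambda>(i, j).
     let (ci, e) = es ! i; (cj, f) = es ! j in
     if i \<noteq> j \<and> ci = c \<and> ends e \<subseteq> ends f then 2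
     else if i \<noteq> j \<and> ci = c \<and> is_link e \<and> card (ends e \<inter> ends f) = 1 then 1
     else 0)"

definition ec_colors :: "nat \<Rightarrow> nat set set" where
  "ec_colors k = {{c, d} | c d. 1 \<le> c \<and> c < d \<and> d \<le> k}"

definition ec_line_adj :: "colored_edge list \<Rightarrow> nat set \<Rightarrow> real mat" where
  "ec_line_adj es p = mat (length es) (length es) (\<lambda>(i, j).
     if {fst (es ! i), fst (es ! j)} = p then (\<Sum>c\<in>p. vc_line_adj es c $$ (i, j)) else 0)"

lemma finite_loop_signed_graph:
  assumes "loop_signed_graph n k G"
  shows "finite G"
proof -
  have "{e. edge_on n e} \<subseteq> Link ` Pow {..<n} \<union> N_loop ` {..<n} \<union> D_loop ` {..<n}"
  proof
    fix e assume "e \<in> {e. edge_on n e}"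
    then show "e \<in> Link ` Pow {..<n} \<union> N_loop ` {..<n} \<union> D_loop ` {..<n}"
      by (cases e) (auto simp: edge_on_def)
  qed
  then have "finite {e. edge_on n e}"
    by (rule finite_subset) auto
  then have "finite ({1..k} \<times> {e. edge_on n e})"
    by simp
  with assms show ?thesis
    unfolding loop_signed_graph_def by (meson finite_subset)
qed

lemma edge_numbering_exists:
  assumes "loop_signed_graph n k G"
  shows "\<exists>es. edge_numbering G es"
proof -
  have "{(c, e). (c, e) \<in> G \<and> \<not> is_D_loop e} \<subseteq> G"
    by auto
  then have "finite {(c, e). (c, e) \<in> G \<and> \<not> is_D_loop e}"
    using finite_loop_signed_graph[OF assms] by (rule finite_subset)
  then obtain xs where "set xs = {(c, e). (c, e) \<in> G \<and> \<not> is_D_loop e}" "distinct xs"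
    using finite_distinct_list by blast
  then have "edge_numbering G (sort_key fst xs)"
    by (simp add: edge_numbering_def)
  then show ?thesis ..
qed

end

theory Submission
  imports Defs "Jordan_Normal_Form.Determinant"
begin

text \<open>
  Call the edges other than D-loops simply the edges. In \<open>I + A\<^sup>c\<close> a \<open>c\<close>-colored link contributes a
  \<open>2\<times>2\<close> block of ones, an N-loop a diagonal entry 2, and a D-loop nothing. Hence \<open>I + A\<^sup>c = Y p\<^sub>c X\<close>,
  where \<open>Y\<close> is the vertex-edge incidence matrix, \<open>X\<close> is its transpose with the rows of loops doubled, and
  \<open>p\<^sub>c\<close> is the coordinate projection onto the \<open>c\<close>-colored edges. In the opposite order, the entry of
  \<open>W = X Y\<close> at \<open>(e, f)\<close> is the number of common vertices of \<open>e\<close> and \<open>f\<close>, doubled if \<open>e\<close> is a loop: off the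
  diagonal this is the entry of the line graph. Two edges of one color are disjoint, so
  \<open>p\<^sub>c W p\<^sub>c = 2 p\<^sub>c\<close>, the vertex-colored line graph has the matrices \<open>p\<^sub>c (W - 2 I)\<close>, and the edge-colored
  one has \<open>p\<^sub>c W p\<^sub>d + p\<^sub>d W p\<^sub>c\<close>. These identities (\<open>factorization\<close>, \<open>b_eq_adj\<close>, \<open>vc_eq_vc_line_adj\<close>,
  \<open>block_eq_ec_line_adj\<close>) are all that is used of the graphs, apart from the fact that their adjacency
  matrices are symmetric signed permutation matrices.

  From (1) to (3), (5) and the direct sum. If \<open>T\<close> is a transplantation matrix for (1), put
  \<open>T\<^sub>L = 1/2 (\<Sum>c. p\<^sub>c X T Y' p\<^sub>c)\<close>. By \<open>p\<^sub>c W p\<^sub>c = 2 p\<^sub>c\<close> it satisfies \<open>W T\<^sub>L = X T Y' = T\<^sub>L W'\<close>, and the same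
  construction applied to the inverse of \<open>T\<close> inverts it (\<open>lift_intertwines\<close>, \<open>lift_inverse\<close>). It
  commutes with every \<open>p\<^sub>c\<close>, so it intertwines all the line graph matrices, and commuting with every
  \<open>p\<^sub>c\<close> is the same as being a direct sum of one square block per color.

  From (4) or (6) to (2). It suffices to recover the traces of products of the matrices
  \<open>I + A\<^sup>c\<close>. Since \<open>(I + A\<^sup>c)\<^sup>2 = 2 (I + A\<^sup>c)\<close>, equal neighbors can be merged, so only words whose
  cyclically adjacent colors differ matter (\<open>trace_words_by_cyclic_reduction\<close>). For these,
  cyclicity of the trace turns \<open>Y p\<^sub>c X Y p\<^sub>d X \<dots>\<close> into \<open>p\<^sub>c W p\<^sub>d W \<dots>\<close>, which is a word in the
  vertex-colored matrices. The corresponding word in the edge-colored matrices has the same trace, or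
  twice that trace if the colors alternate between two values (\<open>trace_E_word\<close>); the factor depends on
  the colors only.

  From (2) to (1). The matrices \<open>A\<^sup>c\<close> generate a finite group of orthogonal matrices, and so do the
  pairs of matrices with the same color. Two representations of a finite group with equal characters
  are equivalent. The proof avoids irreducible representations: it builds an intertwiner \<open>X\<close> together with
  a generalized inverse \<open>Y\<close>. As long as the projection \<open>P = I - X Y\<close> is nonzero, the two representations
  restricted to the complements still have equal characters, so averaging a suitable matrix unit over
  the group gives a nonzero intertwiner of the complements, which can be added to \<open>X\<close>
  (\<open>intertwiner_between_complements\<close>, \<open>invertible_intertwiner_exists\<close>).

  The remaining implications hold because similar matrices have the same trace.
\<close>

section \<open>Finitely supported matrices\<close>

text \<open>Products of \<open>X\<close>, \<open>Y\<close>, \<open>T\<close> mix the sizes \<open>n\<close> and \<open>n\<^sub>L\<close>. Matrices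
  with rows and columns indexed by all natural numbers and finitely many nonzero entries contain every
  size at once and form a real algebra, so that ring arithmetic and sums of matrices need no
  dimension conditions; a size only enters where an identity matrix does.\<close>

typedef fmat = "{f :: nat \<Rightarrow> nat \<Rightarrow> real. \<exists>N. \<forall>i j. f i j \<noteq> 0 \<longrightarrow> i < N \<and> j < N}"
  morphisms entry Abs_fmat
  by (rule exI[of _ "\<lambda>i j. 0"]) simp

setup_lifting type_definition_fmat

lemma fmat_eqI: "(\<And>i j. entry A i j = entry B i j) \<Longrightarrow> A = B"
  by (simp add: entry_inject[symmetric] fun_eq_iff)

definition shape :: "nat \<Rightarrow> nat \<Rightarrow> fmat \<Rightarrow> bool" where
  "shape m n A \<longleftrightarrow> (\<forall>i j. entry A i j \<noteq> 0 \<longrightarrow> i < m \<and> j < n)"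

lemma shapeD: "shape m n A \<Longrightarrow> \<not> (i < m \<and> j < n) \<Longrightarrow> entry A i j = 0"
  unfolding shape_def by blast

lemma shape_mono: "shape m n A \<Longrightarrow> m \<le> m' \<Longrightarrow> n \<le> n' \<Longrightarrow> shape m' n' A"
  unfolding shape_def using less_le_trans by blast

lemma shape_exists: "\<exists>N. shape N N A"
  using entry[of A] unfolding shape_def by auto

lemma common_shape: "\<exists>N. shape N N A \<and> shape N N B \<and> shape N N C"
proof -
  obtain a b c where "shape a a A" "shape b b B" "shape c c C"
    using shape_exists[of A] shape_exists[of B] shape_exists[of C] by auto
  then have "shape (a + b + c) (a + b + c) A" "shape (a + b + c) (a + b + c) B"
    "shape (a + b + c) (a + b + c) C"
    by (simp_all add: shape_mono)
  then show ?thesis by blast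
qed

instantiation fmat :: ab_group_add
begin

lift_definition zero_fmat :: fmat is "\<lambda>i j. 0" by simp

lift_definition plus_fmat :: "fmat \<Rightarrow> fmat \<Rightarrow> fmat" is "\<lambda>f g i j. f i j + g i j"
proof -
  fix f g :: "nat \<Rightarrow> nat \<Rightarrow> real"
  assume "\<exists>N. \<forall>i j. f i j \<noteq> 0 \<longrightarrow> i < N \<and> j < N" and "\<exists>N. \<forall>i j. g i j \<noteq> 0 \<longrightarrow> i < N \<and> j < N"
  then obtain M N where "\<forall>i j. f i j \<noteq> 0 \<longrightarrow> i < M \<and> j < M" "\<forall>i j. g i j \<noteq> 0 \<longrightarrow> i < N \<and> j < N"
    by blast
  then show "\<exists>N. \<forall>i j. f i j + g i j \<noteq> 0 \<longrightarrow> i < N \<and> j < N"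
    by (intro exI[of _ "max M N"]) (metis add.right_neutral less_max_iff_disj)
qed

lift_definition uminus_fmat :: "fmat \<Rightarrow> fmat" is "\<lambda>f i j. - f i j" by simp

definition minus_fmat :: "fmat \<Rightarrow> fmat \<Rightarrow> fmat" where
  "minus_fmat A B = A + - B"

lemma entry_add [simp]: "entry (A + B) i j = entry A i j + entry B i j"
  by transfer simp

lemma entry_zero [simp]: "entry 0 i j = 0"
  by transfer simp

lemma entry_uminus [simp]: "entry (- A) i j = - entry A i j"
  by transfer simp

lemma entry_diff [simp]: "entry (A - B) i j = entry A i j - entry B i j"
  by (simp add: minus_fmat_def)

instance
  by standard (auto intro!: fmat_eqI)

end

lemma entry_sum [simp]: "entry (\<Sum>x\<in>I. f x) i j = (\<Sum>x\<in>I. entry (f x) i j)"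
  by (induction I rule: infinite_finite_induct) auto

instantiation fmat :: real_algebra
begin

lift_definition scaleR_fmat :: "real \<Rightarrow> fmat \<Rightarrow> fmat" is "\<lambda>r f i j. r * f i j"
  by (metis mult_zero_right)

lift_definition times_fmat :: "fmat \<Rightarrow> fmat \<Rightarrow> fmat" is
  "\<lambda>f g i j. \<Sum>k | f i k \<noteq> 0. f i k * g k j"
proof -
  fix f g :: "nat \<Rightarrow> nat \<Rightarrow> real"
  assume "\<exists>N. \<forall>i j. f i j \<noteq> 0 \<longrightarrow> i < N \<and> j < N" and "\<exists>N. \<forall>i j. g i j \<noteq> 0 \<longrightarrow> i < N \<and> j < N"
  then obtain M N where M: "\<forall>i j. f i j \<noteq> 0 \<longrightarrow> i < M \<and> j < M"
    and N: "\<forall>i j. g i j \<noteq> 0 \<longrightarrow> i < N \<and> j < N"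
    by blast
  have "i < max M N \<and> j < max M N" if ne: "(\<Sum>k | f i k \<noteq> 0. f i k * g k j) \<noteq> 0" for i j
  proof -
    obtain k where "f i k * g k j \<noteq> 0"
      using ne by (rule sum.not_neutral_contains_not_neutral)
    then have "i < M" "j < N" using M N by (metis mult_zero_left, metis mult_zero_right)
    then show ?thesis by auto
  qed
  then show "\<exists>N. \<forall>i j. (\<Sum>k | f i k \<noteq> 0. f i k * g k j) \<noteq> 0 \<longrightarrow> i < N \<and> j < N"
    by blast
qed

lemma entry_mult: "shape m n A \<Longrightarrow> entry (A * B) i j = (\<Sum>k<n. entry A i k * entry B k j)"
proof -
  assume A: "shape m n A"
  have "entry (A * B) i j = (\<Sum>k | entry A i k \<noteq> 0. entry A i k * entry B k j)"
    by transfer simp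
  also have "\<dots> = (\<Sum>k<n. entry A i k * entry B k j)"
    using A by (intro sum.mono_neutral_left) (auto simp: shape_def)
  finally show ?thesis .
qed

lemma entry_scaleR [simp]: "entry (r *\<^sub>R A) i j = r * entry A i j"
  by transfer simp

lemma shape_mult_square: "shape N N A \<Longrightarrow> shape N N B \<Longrightarrow> shape N N (A * B)"
  unfolding shape_def
proof (intro allI impI)
  fix i j assume A: "\<forall>i j. entry A i j \<noteq> 0 \<longrightarrow> i < N \<and> j < N" and B: "\<forall>i j. entry B i j \<noteq> 0 \<longrightarrow> i < N \<and> j < N"
    and ne: "entry (A * B) i j \<noteq> 0"
  have "entry (A * B) i j = (\<Sum>k<N. entry A i k * entry B k j)"
    using A by (intro entry_mult) (auto simp: shape_def)
  with ne obtain k where "entry A i k * entry B k j \<noteq> 0"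
    by (metis (mono_tags, lifting) sum.neutral)
  then show "i < N \<and> j < N" using A B by (metis mult_zero_left mult_zero_right)
qed

instance
proof
  fix A B C :: fmat and r s :: real
  obtain N where N: "shape N N A" "shape N N B" "shape N N C"
    using common_shape by blast
  note m = entry_mult[OF N(1)] entry_mult[OF N(2)] entry_mult[OF shape_mult_square[OF N(1,2)]]
  show "A * B * C = A * (B * C)"
    by (rule fmat_eqI, simp add: m sum_distrib_left sum_distrib_right mult.assoc,
        subst sum.swap, simp)
  have AB: "shape N N (A + B)" using N by (auto simp: shape_def) (metis add.right_neutral)+
  have rA: "shape N N (r *\<^sub>R A)" using N by (auto simp: shape_def)
  show "(A + B) * C = A * C + B * C"
    by (rule fmat_eqI) (simp add: m entry_mult[OF AB] algebra_simps sum.distrib)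
  show "A * (B + C) = A * B + A * C"
    by (rule fmat_eqI) (simp add: m algebra_simps sum.distrib)
  show "r *\<^sub>R A * B = r *\<^sub>R (A * B)"
    by (rule fmat_eqI) (simp add: m entry_mult[OF rA] sum_distrib_left algebra_simps)
  show "A * r *\<^sub>R B = r *\<^sub>R (A * B)"
    by (rule fmat_eqI) (simp add: m sum_distrib_left algebra_simps)
qed (auto intro!: fmat_eqI simp: algebra_simps)

end

subsection \<open>Shapes\<close>

lemma entry_mult': 
  assumes "shape n p B"
  shows "entry (A * B) i j = (\<Sum>k<n. entry A i k * entry B k j)"
proof -
  obtain N where N: "shape N N A" using shape_exists by blast
  have "entry (A * B) i j = (\<Sum>k<N. entry A i k * entry B k j)" by (rule entry_mult[OF N])
  also have "\<dots> = (\<Sum>k<max N n. entry A i k * entry B k j)"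
    using N by (intro sum.mono_neutral_left) (auto simp: shapeD)
  also have "\<dots> = (\<Sum>k<n. entry A i k * entry B k j)"
    using assms by (intro sum.mono_neutral_right) (auto simp: shapeD)
  finally show ?thesis .
qed

lemma shape_mult [intro]:
  assumes "shape m n A" "shape p q B" shows "shape m q (A * B)"
  unfolding shape_def
proof (intro allI impI)
  fix i j assume "entry (A * B) i j \<noteq> 0"
  then obtain k where "entry A i k * entry B k j \<noteq> 0"
    unfolding entry_mult[OF assms(1)] by (metis (mono_tags, lifting) sum.neutral)
  then show "i < m \<and> j < q" using assms by (metis shape_def mult_zero_left mult_zero_right)
qed

lemma shape_add [intro]: "shape m n A \<Longrightarrow> shape m n B \<Longrightarrow> shape m n (A + B)"
  unfolding shape_def by (metis add.right_neutral entry_add)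

lemma shape_diff [intro]: "shape m n A \<Longrightarrow> shape m n B \<Longrightarrow> shape m n (A - B)"
  unfolding shape_def by (metis diff_0_right entry_diff)

lemma shape_scaleR [intro]: "shape m n A \<Longrightarrow> shape m n (r *\<^sub>R A)"
  unfolding shape_def by auto

lemma shape_zero [intro, simp]: "shape m n 0"
  unfolding shape_def by simp

lemma shape_sum [intro]: "(\<And>x. x \<in> I \<Longrightarrow> shape m n (f x)) \<Longrightarrow> shape m n (\<Sum>x\<in>I. f x)"
  by (induction I rule: infinite_finite_induct) auto

subsection \<open>Transposition, matrices given by their entries\<close>

lift_definition tpose :: "fmat \<Rightarrow> fmat" is "\<lambda>f i j. f j i"
  by blast

lemma entry_tpose [simp]: "entry (tpose A) i j = entry A j i"
  by transfer simp

lemma shape_tpose [intro]: "shape m n A \<Longrightarrow> shape n m (tpose A)"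
  unfolding shape_def by auto

lemma tpose_tpose [simp]: "tpose (tpose A) = A"
  by (rule fmat_eqI) simp

lemma tpose_mult: "tpose (A * B) = tpose B * tpose A"
proof -
  obtain N where N: "shape N N A" "shape N N B" using common_shape by blast
  show ?thesis
    by (rule fmat_eqI) (simp add: entry_mult[OF N(1)] entry_mult[OF shape_tpose[OF N(2)]] mult.commute)
qed

lemma tpose_add: "tpose (A + B) = tpose A + tpose B"
  and tpose_diff: "tpose (A - B) = tpose A - tpose B"
  and tpose_scaleR: "tpose (r *\<^sub>R A) = r *\<^sub>R tpose A"
  and tpose_zero [simp]: "tpose 0 = 0"
  and tpose_sum: "tpose (\<Sum>x\<in>I. f x) = (\<Sum>x\<in>I. tpose (f x))"
  by (auto intro!: fmat_eqI)

lift_definition fmat_of :: "nat \<Rightarrow> nat \<Rightarrow> (nat \<Rightarrow> nat \<Rightarrow> real) \<Rightarrow> fmat" is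
  "\<lambda>m n f i j. if i < m \<and> j < n then f i j else 0"
  by (metis less_max_iff_disj)

lemma entry_fmat_of: "entry (fmat_of m n f) i j = (if i < m \<and> j < n then f i j else 0)"
  by transfer simp

lemma shape_fmat_of [intro, simp]: "shape m n (fmat_of m n f)"
  by (auto simp: shape_def entry_fmat_of split: if_splits)

text \<open>The algebra has no unit; \<open>idm n\<close> is the unit of its subalgebra of \<open>n \<times> n\<close> matrices.\<close>

definition idm :: "nat \<Rightarrow> fmat" where
  "idm n = fmat_of n n (\<lambda>i j. if i = j then 1 else 0)"

lemma entry_idm: "entry (idm n) i j = (if i = j \<and> i < n then 1 else 0)"
  by (auto simp: idm_def entry_fmat_of)

lemma shape_idm [intro, simp]: "shape n n (idm n)"
  by (simp add: idm_def)

lemma idm_mult [simp]: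
  assumes "shape m n A" shows "idm m * A = A"
proof (rule fmat_eqI)
  fix i j
  have "entry (idm m * A) i j = (\<Sum>k<m. if i = k then entry A k j else 0)"
    unfolding entry_mult[OF shape_idm] by (rule sum.cong) (auto simp: entry_idm)
  then show "entry (idm m * A) i j = entry A i j"
    using assms by (simp add: shapeD)
qed

lemma mult_idm [simp]: "shape m n A \<Longrightarrow> A * idm n = A"
  by (rule fmat_eqI) (auto simp: entry_mult entry_idm sum.delta shapeD
      if_distrib[of "\<lambda>x. _ * x"] cong: if_cong)

lemma tpose_idm [simp]: "tpose (idm n) = idm n"
  by (rule fmat_eqI) (simp add: entry_idm)

definition munit :: "nat \<Rightarrow> nat \<Rightarrow> fmat" where
  "munit a b = fmat_of (Suc a) (Suc b) (\<lambda>i j. if i = a \<and> j = b then 1 else 0)"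

lemma entry_munit: "entry (munit a b) i j = (if i = a \<and> j = b then 1 else 0)"
  by (auto simp: munit_def entry_fmat_of)

lemma shape_munit [intro]: "a < m \<Longrightarrow> b < n \<Longrightarrow> shape m n (munit a b)"
  by (auto simp: shape_def entry_munit split: if_splits)

lemma entry_mult_munit: "entry (A * munit a b) i j = (if j = b then entry A i a else 0)"
proof -
  have "shape (Suc a) (Suc b) (munit a b)" by auto
  from entry_mult'[OF this, of A i j] show ?thesis
    by (simp add: entry_munit if_distrib[of "\<lambda>x. _ * x"] cong: if_cong)
qed

lemma entry_munit_mult: "entry (munit a b * A) i j = (if i = a then entry A b j else 0)"
proof -
  have "shape (Suc a) (Suc b) (munit a b)" by auto
  from entry_mult[OF this, of A i j] show ?thesis
    by (simp add: entry_munit if_distrib[of "\<lambda>x. x * _"] cong: if_cong)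
qed

subsection \<open>The trace\<close>

lift_definition trace :: "fmat \<Rightarrow> real" is "\<lambda>f. \<Sum>i | f i i \<noteq> 0. f i i" .

lemma trace_shape: "shape m n A \<Longrightarrow> trace A = (\<Sum>i<m. entry A i i)"
proof -
  assume A: "shape m n A"
  have "trace A = (\<Sum>i | entry A i i \<noteq> 0. entry A i i)" by transfer simp
  also have "\<dots> = (\<Sum>i<m. entry A i i)"
    using A by (intro sum.mono_neutral_left) (auto simp: shape_def)
  finally show ?thesis .
qed

lemma trace_tpose [simp]: "trace (tpose A) = trace A"
  by transfer simp

lemma trace_zero [simp]: "trace 0 = 0"
  by transfer simp

lemma trace_add: "trace (A + B) = trace A + trace B"
  and trace_diff: "trace (A - B) = trace A - trace B"
  and trace_scaleR: "trace (r *\<^sub>R A) = r * trace A"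
proof -
  obtain N where N: "shape N N A" "shape N N B" using common_shape by blast
  note sh = shape_add[OF N] shape_diff[OF N] shape_scaleR[OF N(1)]
  show "trace (A + B) = trace A + trace B" "trace (A - B) = trace A - trace B"
    "trace (r *\<^sub>R A) = r * trace A"
    by (simp_all add: sh[THEN trace_shape] N[THEN trace_shape] sum.distrib sum_subtractf sum_distrib_left)
qed

lemma trace_comm: "trace (A * B) = trace (B * A)"
proof -
  obtain N where N: "shape N N A" "shape N N B" using common_shape by blast
  note sh = shape_mult[OF N] shape_mult[OF N(2,1)]
  show ?thesis
    by (simp add: sh[THEN trace_shape] entry_mult[OF N(1)] entry_mult[OF N(2)] mult.commute,
        subst sum.swap, simp)
qed

lemma trace_idm [simp]: "trace (idm n) = real n"
  by (simp add: trace_shape[OF shape_idm] entry_idm)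

lemma trace_munit: "trace (munit j j) = 1"
  by (simp add: trace_shape[OF shape_munit[of j "Suc j" j "Suc j"]] entry_munit)

lemma trace_mult_tpose:
  assumes "shape m n A"
  shows "trace (A * tpose A) = (\<Sum>i<m. \<Sum>j<n. (entry A i j)\<^sup>2)"
  by (simp add: trace_shape[OF shape_mult[OF assms shape_tpose[OF assms]]] entry_mult[OF assms]
      power2_eq_square)

lemma trace_mult_tpose_nonneg: "0 \<le> trace (A * tpose A)"
  using shape_exists[of A] by (auto simp: trace_mult_tpose sum_nonneg)

lemma trace_mult_tpose_eq_0: "trace (A * tpose A) = 0 \<Longrightarrow> A = 0"
proof (rule fmat_eqI)
  fix i j assume tr0: "trace (A * tpose A) = 0"
  obtain N where N: "shape N N A" using shape_exists by blast
  show "entry A i j = entry 0 i j"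
  proof (cases "i < N \<and> j < N")
    case True
    have "(\<Sum>i<N. \<Sum>j<N. (entry A i j)\<^sup>2) = 0" using tr0 trace_mult_tpose[OF N] by simp
    then have "(\<Sum>j<N. (entry A i j)\<^sup>2) = 0" using True
      by (subst (asm) sum_nonneg_eq_0_iff) (auto intro: sum_nonneg)
    then show ?thesis using True by (subst (asm) sum_nonneg_eq_0_iff) auto
  qed (use N in \<open>auto simp: shapeD\<close>)
qed

subsection \<open>Comparison with the matrices of fixed dimensions\<close>

definition of_mat :: "real mat \<Rightarrow> fmat" where
  "of_mat A = fmat_of (dim_row A) (dim_col A) (\<lambda>i j. A $$ (i, j))"

definition to_mat :: "nat \<Rightarrow> nat \<Rightarrow> fmat \<Rightarrow> real mat" where
  "to_mat m n A = mat m n (\<lambda>(i, j). entry A i j)"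

lemma to_mat_carrier [simp]: "to_mat m n A \<in> carrier_mat m n"
  by (simp add: to_mat_def)

lemma entry_of_mat:
  "A \<in> carrier_mat m n \<Longrightarrow> entry (of_mat A) i j = (if i < m \<and> j < n then A $$ (i, j) else 0)"
  by (auto simp: of_mat_def entry_fmat_of)

lemma shape_of_mat [intro]: "A \<in> carrier_mat m n \<Longrightarrow> shape m n (of_mat A)"
  by (auto simp: of_mat_def)

lemma of_mat_to_mat [simp]: "shape m n A \<Longrightarrow> of_mat (to_mat m n A) = A"
  by (rule fmat_eqI) (auto simp: entry_of_mat[of _ m n] to_mat_def shapeD)

lemma of_mat_inj:
  assumes "A \<in> carrier_mat m n" "B \<in> carrier_mat m n" "of_mat A = of_mat B"
  shows "A = B"
proof (rule eq_matI)
  fix i j assume "i < dim_row B" "j < dim_col B"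
  then show "A $$ (i, j) = B $$ (i, j)"
    using entry_of_mat[OF assms(1), of i j] entry_of_mat[OF assms(2), of i j] assms by auto
qed (use assms in auto)

lemma of_mat_mult:
  assumes "A \<in> carrier_mat m n" "B \<in> carrier_mat n p"
  shows "of_mat (A * B) = of_mat A * of_mat B"
proof (rule fmat_eqI)
  fix i j
  have AB: "A * B \<in> carrier_mat m p" using assms by simp
  show "entry (of_mat (A * B)) i j = entry (of_mat A * of_mat B) i j"
    using assms by (auto simp: entry_of_mat[OF AB] entry_mult[OF shape_of_mat[OF assms(1)]]
        entry_of_mat[OF assms(1)] entry_of_mat[OF assms(2)] scalar_prod_def atLeast0LessThan
        intro!: sum.cong)
qed

lemma of_mat_add:
  assumes "A \<in> carrier_mat m n" "B \<in> carrier_mat m n"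
  shows "of_mat (A + B) = of_mat A + of_mat B"
  using assms by (intro fmat_eqI) (auto simp: entry_of_mat[of _ m n])

lemma of_mat_one [simp]: "of_mat (1\<^sub>m n) = idm n"
  by (rule fmat_eqI) (auto simp: entry_of_mat[of _ n n] entry_idm)

lemma mat_trace_eq_trace: "A \<in> carrier_mat n n \<Longrightarrow> mat_trace A = trace (of_mat A)"
  by (auto simp: mat_trace_def trace_shape[OF shape_of_mat] entry_of_mat)

text \<open>This needs finite dimension, hence the passage through matrices of a fixed size and their determinants.\<close>

lemma right_inverse_imp_left_inverse:
  assumes "shape n n A" "shape n n B" "A * B = idm n"
  shows "B * A = idm n"
proof -
  have "to_mat n n A * to_mat n n B \<in> carrier_mat n n"
    by (rule mult_carrier_mat[OF to_mat_carrier to_mat_carrier])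
  then have "to_mat n n A * to_mat n n B = 1\<^sub>m n"
    by (rule of_mat_inj[of _ n n])
      (simp_all add: assms of_mat_mult[OF to_mat_carrier[of n n] to_mat_carrier[of n n]])
  then have "to_mat n n B * to_mat n n A = 1\<^sub>m n"
    by (rule mat_mult_left_right_inverse[OF to_mat_carrier to_mat_carrier])
  then have "of_mat (to_mat n n B * to_mat n n A) = idm n" by simp
  then show ?thesis 
    by (simp add: assms of_mat_mult[OF to_mat_carrier[of n n] to_mat_carrier[of n n]])
qed

section \<open>Least-squares inverses\<close>

lemma mult_extend_right:
  fixes A B C D :: fmat
  shows "A * B = C \<Longrightarrow> A * (B * D) = C * D"
  by (simp add: mult.assoc[symmetric])

lemma commute_complement:
  assumes "shape n n x" "x * A = A * x"
  shows "x * (idm n - A) = (idm n - A) * x"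
  using assms by (simp add: left_diff_distrib right_diff_distrib)

text \<open>The two maximality arguments below enlarge a generalized inverse step by step; the trace of the
  associated projection rises by at least 1 each time and is bounded by the dimension.\<close>

lemma bounded_ascent:
  fixes f :: "'a \<Rightarrow> real"
  assumes step: "\<And>x. Q x \<Longrightarrow> \<not> R x \<Longrightarrow> \<exists>y. Q y \<and> f x + 1 \<le> f y"
    and bound: "\<And>x. Q x \<Longrightarrow> f x \<le> b" and start: "Q x0"
  shows "\<exists>x. Q x \<and> R x"
proof (rule ccontr)
  assume none: "\<not> ?thesis"
  have climb: "\<exists>x. Q x \<and> f x0 + real m \<le> f x" for m
  proof (induction m)
    case (Suc m)
    then obtain x where "Q x" "f x0 + real m \<le> f x" by blast
    moreover from this obtain y where "Q y" "f x + 1 \<le> f y" using step none by blast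
    ultimately show ?case by (intro exI[of _ y]) auto
  qed (use start in auto)
  obtain m where "b - f x0 < real m" using reals_Archimedean2 by blast
  with climb[of m] bound show False by fastforce
qed

lemma munit_sandwich: "munit a a * M * munit a a = entry M a a *\<^sub>R munit a a"
  by (rule fmat_eqI) (simp add: entry_mult_munit entry_munit_mult entry_munit)

text \<open>A nonzero column \<open>z\<close> of a matrix, stored in place so that it stays in the algebra: \<open>z\<^sup>T z\<close> is a
  multiple of a diagonal matrix unit, and \<open>z z\<^sup>T / s\<close> is the orthogonal projection onto the line of \<open>z\<close>.\<close>

lemma nonzero_column:
  assumes "shape n n Z" "Z \<noteq> 0"
  obtains j s where "j < n" "0 < s"
    "tpose (Z * munit j j) * (Z * munit j j) = s *\<^sub>R munit j j"
proof -
  obtain i j where ij: "entry Z i j \<noteq> 0" using assms(2) fmat_eqI[of Z 0] by auto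
  then have j: "j < n" using assms(1) by (auto simp: shape_def)
  let ?z = "Z * munit j j" and ?s = "entry (tpose Z * Z) j j"
  have tp: "tpose (munit j j) = munit j j"
    by (rule fmat_eqI) (auto simp: entry_munit)
  have eq: "tpose ?z * ?z = ?s *\<^sub>R munit j j"
    using munit_sandwich[of j "tpose Z * Z"] by (simp add: tpose_mult tp mult.assoc)
  have "?z \<noteq> 0"
  proof
    assume "?z = 0"
    then have "entry ?z i j = 0" by simp
    then show False using ij by (simp add: entry_mult_munit)
  qed
  then have "trace (?z * tpose ?z) \<noteq> 0" using trace_mult_tpose_eq_0 by blast
  then have "0 < trace (?z * tpose ?z)" using trace_mult_tpose_nonneg[of ?z] by simp
  also have "\<dots> = ?s" by (simp add: trace_comm[of ?z] eq trace_scaleR trace_munit)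
  finally show ?thesis using that[OF j _ eq] by blast
qed

text \<open>For a symmetric idempotent, the trace is the sum of the squares of the entries.\<close>

lemma trace_symmetric_idempotent:
  assumes "tpose E = E" "E * E = E"
  shows "0 \<le> trace E" "trace E = 0 \<Longrightarrow> E = 0"
  using trace_mult_tpose_nonneg[of E] trace_mult_tpose_eq_0[of E] assms by auto

text \<open>Split off the orthogonal projection \<open>F\<close> onto a nonzero column: \<open>F\<close> has trace 1 and \<open>E - F\<close> is again a
  symmetric idempotent.\<close>

lemma trace_symmetric_idempotent_ge_1:
  assumes E: "tpose E = E" "E * E = E" and "E \<noteq> 0"
  shows "1 \<le> trace E"
proof -
  obtain n where n: "shape n n E" using shape_exists by blast
  obtain j s where s: "0 < s" and
    zz: "tpose (E * munit j j) * (E * munit j j) = s *\<^sub>R munit j j"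
    by (rule nonzero_column[OF n \<open>E \<noteq> 0\<close>])
  define z where "z = E * munit j j"
  define F where "F = (1 / s) *\<^sub>R (z * tpose z)"
  have zz: "tpose z * z = s *\<^sub>R munit j j" using zz by (simp add: z_def)
  have zu: "z * munit j j = z"
    by (rule fmat_eqI) (simp add: z_def entry_mult_munit)
  have Ez: "E * z = z" using E by (simp add: z_def mult.assoc[symmetric])
  have zE: "tpose z * E = tpose z" using arg_cong[OF Ez, of tpose] E by (simp add: tpose_mult)
  have ut: "munit j j * tpose z = tpose z"
    by (rule fmat_eqI) (simp add: z_def entry_mult_munit entry_munit_mult)
  have tF: "tpose F = F" by (simp add: F_def tpose_scaleR tpose_mult)
  have EF: "E * F = F" by (simp add: F_def Ez mult.assoc[symmetric])
  have FE: "F * E = F" by (simp add: F_def zE mult.assoc)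
  have FF: "F * F = F"
    using s by (simp add: F_def mult.assoc mult_extend_right[OF zz] ut)
  have "0 \<le> trace (E - F)"
    by (rule trace_symmetric_idempotent)
      (simp_all add: tpose_diff tF E algebra_simps EF FE FF)
  moreover have "trace F = 1"
    using s by (simp add: F_def trace_scaleR trace_comm[of z] zz trace_munit)
  ultimately show ?thesis by (simp add: trace_diff)
qed

text \<open>Gram-Schmidt in matrix form. Given \<open>L K L = L\<close> with \<open>K L\<close> an orthogonal projection, \<open>K L\<close> projects onto
  the part of the column space of \<open>K\<close> found so far. If \<open>K L K \<noteq> K\<close>, some column \<open>z\<close> of \<open>K - K L K\<close> is nonzero
  and orthogonal to that part, and \<open>L\<close> can be changed so that \<open>K L\<close> grows by the projection onto \<open>z\<close>.\<close>

lemma least_squares_inverse_exists: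
  assumes K: "shape n n K"
  shows "\<exists>L. shape n n L \<and> K * L * K = K \<and> tpose (K * L) = K * L"
proof -
  let ?Q = "\<lambda>L. shape n n L \<and> L * K * L = L \<and> tpose (K * L) = K * L"
  have "\<exists>L. ?Q L \<and> K * L * K = K"
  proof (rule bounded_ascent[where f = "\<lambda>L. trace (K * L)" and b = "real n"])
    show "?Q 0" by simp
  next
    fix L assume L: "?Q L"
    let ?E = "idm n - K * L"
    have sh: "shape n n (K * L)" using K L by blast
    have "K * L * (K * L) = K * L" using L by (simp add: mult.assoc)
    then have "0 \<le> trace ?E"
      using L by (intro trace_symmetric_idempotent)
        (simp_all add: tpose_diff left_diff_distrib right_diff_distrib idm_mult[OF sh] mult_idm[OF sh]
          idm_mult[OF shape_idm])
    then show "trace (K * L) \<le> real n" by (simp add: trace_diff)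
  next
    fix L assume L: "?Q L" and "K * L * K \<noteq> K"
    define Z where "Z = K - K * L * K"
    have Z: "shape n n Z" "Z \<noteq> 0" using K L \<open>K * L * K \<noteq> K\<close> by (auto simp: Z_def)
    obtain j s where j: "j < n" and s: "0 < s" and
      zz: "tpose (Z * munit j j) * (Z * munit j j) = s *\<^sub>R munit j j"
      by (rule nonzero_column[OF Z])
    define z where "z = Z * munit j j"
    \<comment> \<open>A preimage of \<open>z\<close> under \<open>K\<close> that \<open>L K\<close> annihilates, so that the correction \<open>M\<close> does not disturb \<open>L\<close>.\<close>
    define x where "x = munit j j - L * K * munit j j"
    define M where "M = (1 / s) *\<^sub>R (x * tpose z)"
    have zz: "tpose z * z = s *\<^sub>R munit j j" using zz by (simp add: z_def)
    have LKL: "L * (K * L) = L" using L by (simp add: mult.assoc)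
    have ut: "munit j j * tpose z = tpose z"
      by (rule fmat_eqI) (simp add: z_def entry_mult_munit entry_munit_mult)
    have xu: "x * munit j j = x"
      by (rule fmat_eqI) (simp add: x_def entry_mult_munit entry_munit mult.assoc[symmetric])
    have shx: "shape n n x" and shz: "shape n n z"
      using j K L Z(1) by (auto simp: x_def z_def)
    have Kx: "K * x = z" by (simp add: x_def z_def Z_def algebra_simps)
    have LKx: "L * (K * x) = 0"
      by (simp add: x_def algebra_simps)
        (simp add: mult.assoc[symmetric], simp add: mult.assoc LKL)
    have KLz: "K * L * z = 0" using LKx Kx by (simp add: mult.assoc)
    have zKL: "tpose z * (K * L) = 0"
      using arg_cong[OF KLz, of tpose] L by (simp add: tpose_mult[of "K * L" z])
    have KM: "K * M = (1 / s) *\<^sub>R (z * tpose z)"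
      by (simp add: M_def mult.assoc[symmetric] Kx)
    have MKM: "M * (K * M) = M"
      unfolding KM using s by (simp add: M_def mult.assoc mult_extend_right[OF zz] ut)
    have LKM: "L * (K * M) = 0"
      using LKx by (simp add: M_def mult_extend_right[OF LKx] mult.assoc[symmetric])
    have MKL: "M * (K * L) = 0"
      by (simp add: M_def mult.assoc zKL)
    have sym: "tpose (K * M) = K * M"
      by (simp add: KM tpose_scaleR tpose_mult)
    have shM: "shape n n M" using shx shz by (auto simp: M_def)
    have "trace (K * M) = 1"
      using s by (simp add: KM trace_scaleR trace_comm[of z] zz trace_munit)
    then have tr: "trace (K * (L + M)) = trace (K * L) + 1"
      by (simp add: distrib_left trace_add)
    have "?Q (L + M)"
    proof (intro conjI)
      show "shape n n (L + M)" using shM L by blast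
      show "(L + M) * K * (L + M) = L + M"
        by (simp add: distrib_left distrib_right mult.assoc LKL LKM MKL MKM)
      show "tpose (K * (L + M)) = K * (L + M)"
        using L sym by (simp add: distrib_left tpose_add)
    qed
    with tr show "\<exists>M. ?Q M \<and> trace (K * L) + 1 \<le> trace (K * M)"
      by (intro exI[of _ "L + M"]) simp
  qed
  then show ?thesis by blast
qed

section \<open>Finite orthogonal groups with equal traces\<close>

text \<open>Two representations of one finite group, encoded by their graph: \<open>(x, y)\<close> says that some group element
  acts by \<open>x\<close> on one space and by \<open>y\<close> on the other.\<close>

locale equal_trace_group =
  fixes n :: nat and \<Gamma> :: "(fmat \<times> fmat) set"
  assumes finite: "finite \<Gamma>"
    and one: "(idm n, idm n) \<in> \<Gamma>"
    and mult: "(x, y) \<in> \<Gamma> \<Longrightarrow> (u, v) \<in> \<Gamma> \<Longrightarrow> (x * u, y * v) \<in> \<Gamma>"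
    and inverse: "(x, y) \<in> \<Gamma> \<Longrightarrow> (tpose x, tpose y) \<in> \<Gamma>"
    and shapes: "(x, y) \<in> \<Gamma> \<Longrightarrow> shape n n x \<and> shape n n y"
    and orthogonal: "(x, y) \<in> \<Gamma> \<Longrightarrow> tpose x * x = idm n \<and> tpose y * y = idm n"
    and traces: "(x, y) \<in> \<Gamma> \<Longrightarrow> trace x = trace y"
begin

lemma orthogonal': "(x, y) \<in> \<Gamma> \<Longrightarrow> x * tpose x = idm n \<and> y * tpose y = idm n"
  using orthogonal[OF inverse] by simp

definition intertwines :: "fmat \<Rightarrow> bool" where
  "intertwines K \<longleftrightarrow> shape n n K \<and> (\<forall>(x, y)\<in>\<Gamma>. x * K = K * y)"

lemma intertwines_add:
  assumes "intertwines K" "intertwines L" shows "intertwines (K + L)"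
proof -
  have "x * (K + L) = (K + L) * y" if "(x, y) \<in> \<Gamma>" for x y
  proof -
    have "x * K = K * y" "x * L = L * y" using assms that unfolding intertwines_def by auto
    then show ?thesis by (simp add: distrib_left distrib_right)
  qed
  then show ?thesis using assms unfolding intertwines_def by auto
qed

text \<open>As \<open>y\<close> is orthogonal, \<open>tpose y\<close> is its inverse, and this is the average of the conjugates of \<open>M\<close>.\<close>

definition average :: "fmat \<Rightarrow> fmat" where
  "average M = (1 / real (card \<Gamma>)) *\<^sub>R (\<Sum>(x, y)\<in>\<Gamma>. x * M * tpose y)"

lemma card_pos: "0 < card \<Gamma>"
  using finite one by (auto simp: card_gt_0_iff)

text \<open>Left multiplication by a group element permutes the summands.\<close>

lemma intertwines_average:
  assumes M: "shape n n M"
  shows "intertwines (average M)"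
  unfolding intertwines_def
proof (intro conjI ballI, goal_cases)
  case 1
  show ?case using M shapes unfolding average_def by (fastforce simp: case_prod_beta)
next
  case (2 g)
  obtain u v where g: "g = (u, v)" and uv: "(u, v) \<in> \<Gamma>" using 2 by (cases g) auto
  have "u * (\<Sum>(x, y)\<in>\<Gamma>. x * M * tpose y) = (\<Sum>(x, y)\<in>\<Gamma>. u * (x * M * tpose y))"
    by (simp add: sum_distrib_left case_prod_beta)
  also have "\<dots> = (\<Sum>(x, y)\<in>\<Gamma>. x * M * tpose y * v)"
  proof (rule sum.reindex_bij_witness[where j = "\<lambda>(x, y). (u * x, v * y)"
        and i = "\<lambda>(x, y). (tpose u * x, tpose v * y)"])
    fix a assume a: "a \<in> \<Gamma>"
    obtain x y where xy: "a = (x, y)" by (cases a)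
    then have sh: "shape n n x" "shape n n y" using a shapes by auto
    note o = orthogonal[OF uv] orthogonal'[OF uv]
    show "(case (case a of (x, y) \<Rightarrow> (u * x, v * y)) of (x, y) \<Rightarrow> (tpose u * x, tpose v * y)) = a"
      "(case (case a of (x, y) \<Rightarrow> (tpose u * x, tpose v * y)) of (x, y) \<Rightarrow> (u * x, v * y)) = a"
      using o sh by (simp_all add: xy mult.assoc[symmetric])
    show "(case a of (x, y) \<Rightarrow> (u * x, v * y)) \<in> \<Gamma>"
      "(case a of (x, y) \<Rightarrow> (tpose u * x, tpose v * y)) \<in> \<Gamma>"
      using a uv mult inverse by (auto simp: xy)
    have "tpose (v * y) * v = tpose y"
      using o mult_idm[OF shape_tpose[OF sh(2)]] by (simp add: tpose_mult mult.assoc)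
    then show "(case case a of (x, y) \<Rightarrow> (u * x, v * y) of (x, y) \<Rightarrow> x * M * tpose y * v) =
        (case a of (x, y) \<Rightarrow> u * (x * M * tpose y))"
      by (simp add: xy mult.assoc)
  qed
  also have "\<dots> = (\<Sum>(x, y)\<in>\<Gamma>. x * M * tpose y) * v"
    by (simp add: sum_distrib_right case_prod_beta)
  finally show ?case by (simp add: g average_def)
qed

lemma intertwines_tpose: 
  assumes "intertwines (tpose K)" "(x, y) \<in> \<Gamma>" shows "y * K = K * x"
proof -
  have "tpose x * tpose K = tpose K * tpose y"
    using assms inverse unfolding intertwines_def by blast
  then show ?thesis by (metis tpose_mult tpose_tpose)
qed

text \<open>Averaging keeps both properties of a least-squares inverse \<open>L\<close> of an intertwiner \<open>K\<close>, because they are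
  affine in \<open>L\<close> and invariant under the group.\<close>

lemma equivariant_least_squares_inverse:
  assumes K: "intertwines K"
  obtains L where "intertwines (tpose L)" "K * L * K = K" "tpose (K * L) = K * L"
proof -
  have shK: "shape n n K" and xK: "\<And>x y. (x, y) \<in> \<Gamma> \<Longrightarrow> x * K = K * y"
    using K unfolding intertwines_def by auto
  obtain L0 where L0: "shape n n L0" "K * L0 * K = K" "tpose (K * L0) = K * L0"
    using least_squares_inverse_exists[OF shK] by blast
  let ?L = "tpose (average (tpose L0))"
  have L: "?L = (1 / real (card \<Gamma>)) *\<^sub>R (\<Sum>(x, y)\<in>\<Gamma>. y * L0 * tpose x)"
    by (simp add: average_def tpose_scaleR tpose_sum tpose_mult case_prod_beta mult.assoc)
  have KL: "K * ?L = (1 / real (card \<Gamma>)) *\<^sub>R (\<Sum>(x, y)\<in>\<Gamma>. x * (K * L0) * tpose x)"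
    unfolding L
    by (auto simp: sum_distrib_left xK mult.assoc[symmetric] case_prod_beta intro!: sum.cong)
  show ?thesis
  proof
    show "intertwines (tpose ?L)" using intertwines_average[OF shape_tpose[OF L0(1)]] by simp
    show "tpose (K * ?L) = K * ?L"
      unfolding KL using L0(3)
      by (simp add: tpose_scaleR tpose_sum tpose_mult case_prod_beta mult.assoc)
    have "x * (K * L0) * tpose x * K = K" if xy: "(x, y) \<in> \<Gamma>" for x y
    proof -
      have "x * (K * L0) * tpose x * K = x * (K * L0 * K) * tpose y"
        using xK[OF inverse[OF xy]] by (simp add: mult.assoc)
      also have "\<dots> = K * (y * tpose y)" by (simp add: L0 xK[OF xy] mult.assoc[symmetric])
      finally show ?thesis using orthogonal'[OF xy] shK by simp
    qed
    then have "(\<Sum>(x, y)\<in>\<Gamma>. x * (K * L0) * tpose x) * K = (\<Sum>(x, y)\<in>\<Gamma>. K)"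
      unfolding sum_distrib_right by (intro sum.cong) auto
    then show "K * ?L * K = K"
      unfolding KL using card_pos by (simp add: case_prod_beta sum_constant_scaleR)
  qed
qed

text \<open>The projections \<open>P = I - X Y\<close> and \<open>P' = I - Y X\<close> commute with the group, and \<open>tr (P x) = tr (P' y)\<close>. If
  every average of a matrix unit vanished after multiplication by \<open>P\<close> and \<open>P'\<close>, summing the diagonal entries would give
  \<open>\<Sum> tr (P x) tr (P' y\<^sup>T) = \<Sum> (tr (P x))\<^sup>2 = 0\<close>, but the unit of the group contributes \<open>(tr P)\<^sup>2 > 0\<close>.
  The symmetry of \<open>P\<close> is what makes \<open>tr (P x\<^sup>T)\<close> equal to \<open>tr (P x)\<close>.\<close>

lemma intertwiner_between_complements:
  assumes X: "intertwines X" and Y: "intertwines (tpose Y)"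
    and XYX: "X * Y * X = X" and YXY: "Y * X * Y = Y" and sym: "tpose (X * Y) = X * Y"
    and ne: "X * Y \<noteq> idm n"
  obtains K where "intertwines K" "K \<noteq> 0" "Y * K = 0" "K * Y = 0"
proof -
  have shX: "shape n n X" and xX: "\<And>x y. (x, y) \<in> \<Gamma> \<Longrightarrow> x * X = X * y"
    using X unfolding intertwines_def by auto
  have shY: "shape n n Y" using Y shape_tpose[of n n "tpose Y"] unfolding intertwines_def by auto
  have yY: "\<And>x y. (x, y) \<in> \<Gamma> \<Longrightarrow> y * Y = Y * x" using intertwines_tpose[OF Y] by auto
  have shXY: "shape n n (X * Y)" "shape n n (Y * X)" using shX shY by auto
  define P where "P = idm n - X * Y"
  define P' where "P' = idm n - Y * X"
  have shP: "shape n n P" "shape n n P'" using shXY by (auto simp: P_def P'_def)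
  have idem: "X * Y * (X * Y) = X * Y" using XYX by (simp add: mult.assoc[symmetric])
  have PP: "P * P = P"
    using idem by (simp add: P_def left_diff_distrib right_diff_distrib
        idm_mult[OF shXY(1)] mult_idm[OF shXY(1)] idm_mult[OF shape_idm])
  have tP: "tpose P = P" using sym by (simp add: P_def tpose_diff)
  have "x * (X * Y) = X * Y * x" "y * (Y * X) = Y * X * y" if "(x, y) \<in> \<Gamma>" for x y
    using xX[OF that] yY[OF that] by (metis mult.assoc)+
  then have Px: "x * P = P * x" and P'y: "y * P' = P' * y" if "(x, y) \<in> \<Gamma>" for x y
    using shapes[OF that] that by (simp_all add: P_def P'_def commute_complement)
  have tr: "trace (P' * y) = trace (P * x)" if "(x, y) \<in> \<Gamma>" for x y
  proof -
    have "trace (Y * X * y) = trace (Y * (x * X))" using xX[OF that] by (simp add: mult.assoc)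
    also have "\<dots> = trace (x * (X * Y))" by (simp add: trace_comm[of Y] mult.assoc)
    also have "\<dots> = trace (X * Y * x)" by (rule trace_comm)
    finally have "trace (Y * X * y) = trace (X * Y * x)" .
    then show ?thesis
      using shapes[OF that, THEN conjunct1] shapes[OF that, THEN conjunct2] traces[OF that]
      by (simp add: P_def P'_def left_diff_distrib trace_diff)
  qed
  have "\<exists>i<n. \<exists>j<n. P * average (munit i j) * P' \<noteq> 0"
  proof (rule ccontr)
    assume "\<not> ?thesis"
    then have zero: "P * average (munit i j) * P' = 0" if "i < n" "j < n" for i j
      using that by blast
    have summand: "(\<Sum>(x, y)\<in>\<Gamma>. entry (P * x) i i * entry (tpose y * P') j j) = 0"
      if "i < n" "j < n" for i j
    proof -
      have "(1 / real (card \<Gamma>)) *\<^sub>R (\<Sum>(x, y)\<in>\<Gamma>. (P * x) * munit i j * (tpose y * P')) = 0"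
        using zero[OF that]
        by (simp add: average_def sum_distrib_left sum_distrib_right case_prod_beta mult.assoc
            del: divide_eq_0_iff scaleR_eq_0_iff scale_eq_0_iff)
      then have "(\<Sum>(x, y)\<in>\<Gamma>. (P * x) * munit i j * (tpose y * P')) = 0"
        using card_pos by simp
      then have "entry (\<Sum>(x, y)\<in>\<Gamma>. (P * x) * munit i j * (tpose y * P')) i j = 0" by simp
      moreover have "entry (A * munit i j * B) i j = entry A i i * entry B j j" for A B
      proof -
        obtain N where N: "shape N N B" using shape_exists by blast
        have "entry (A * munit i j * B) i j = (\<Sum>k<N. entry (A * munit i j) i k * entry B k j)"
          by (rule entry_mult'[OF N])
        also have "\<dots> = entry A i i * entry B j j"
          using N by (auto simp: entry_mult_munit if_distrib[of "\<lambda>x. x * _"] shapeD cong: if_cong)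
        finally show ?thesis .
      qed
      ultimately show ?thesis by (simp add: case_prod_beta)
    qed
    have "(\<Sum>(x, y)\<in>\<Gamma>. trace (P * x) * trace (tpose y * P')) =
        (\<Sum>(x, y)\<in>\<Gamma>. (\<Sum>i<n. \<Sum>j<n. entry (P * x) i i * entry (tpose y * P') j j))"
    proof (rule sum.cong)
      fix a assume "a \<in> \<Gamma>"
      moreover obtain x y where "a = (x, y)" by (cases a)
      ultimately have "shape n n (P * x)" "shape n n (tpose y * P')" and xy: "a = (x, y)"
        using shapes shP by (auto intro: shape_mult shape_tpose)
      then show "(case a of (x, y) \<Rightarrow> trace (P * x) * trace (tpose y * P')) =
        (case a of (x, y) \<Rightarrow> \<Sum>i<n. \<Sum>j<n. entry (P * x) i i * entry (tpose y * P') j j)"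
        by (simp add: trace_shape sum_product)
    qed simp
    also have "\<dots> = (\<Sum>i<n. \<Sum>j<n. \<Sum>(x, y)\<in>\<Gamma>. entry (P * x) i i * entry (tpose y * P') j j)"
      unfolding case_prod_beta
      by (subst sum.swap, rule sum.cong[OF refl], subst sum.swap, rule refl)
    also have "\<dots> = 0" using summand by simp
    finally have "(\<Sum>(x, y)\<in>\<Gamma>. trace (P * x) * trace (tpose y * P')) = 0" .
    moreover have square: "trace (tpose y * P') = trace (P * x)" if "(x, y) \<in> \<Gamma>" for x y
    proof -
      have "trace (tpose y * P') = trace (P * tpose x)"
        using tr[OF inverse[OF that]] by (simp add: trace_comm)
      also have "\<dots> = trace (tpose (P * tpose x))" by simp
      also have "\<dots> = trace (P * x)" using tP by (simp add: tpose_mult trace_comm)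
      finally show ?thesis .
    qed
    moreover have "(\<Sum>(x, y)\<in>\<Gamma>. trace (P * x) * trace (tpose y * P')) =
        (\<Sum>a\<in>\<Gamma>. trace (P * fst a) * trace (P * fst a))"
      by (rule sum.cong) (auto simp: square)
    ultimately have "(\<Sum>a\<in>\<Gamma>. trace (P * fst a) * trace (P * fst a)) = 0" by simp
    then have "trace (P * idm n) = 0"
      using one finite by (subst (asm) sum_nonneg_eq_0_iff) auto
    then have "P = 0" using trace_symmetric_idempotent[OF tP PP] shP by simp
    then show False using ne by (simp add: P_def)
  qed
  then obtain i j where ij: "i < n" "j < n" "P * average (munit i j) * P' \<noteq> 0" by blast
  let ?M = "average (munit i j)"
  have M: "shape n n ?M" "\<And>x y. (x, y) \<in> \<Gamma> \<Longrightarrow> x * ?M = ?M * y"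
    using intertwines_average[OF shape_munit[OF ij(1,2)]] unfolding intertwines_def by auto
  have "x * (P * ?M * P') = P * ?M * P' * y" if "(x, y) \<in> \<Gamma>" for x y
  proof -
    have "x * (P * ?M * P') = P * (x * ?M) * P'"
      by (simp add: mult.assoc[symmetric] Px[OF that])
    also have "\<dots> = P * ?M * (y * P')" by (simp add: M(2)[OF that] mult.assoc)
    finally show ?thesis by (simp add: P'y[OF that] mult.assoc)
  qed
  then have "intertwines (P * ?M * P')"
    using M shP unfolding intertwines_def by blast
  moreover have "Y * P = 0" using YXY shY by (simp add: P_def algebra_simps)
  then have "Y * (P * ?M * P') = 0" by (simp add: mult.assoc[symmetric])
  moreover have "P' * Y = 0" using YXY shY by (simp add: P'_def algebra_simps)
  then have "P * ?M * P' * Y = 0" by (simp add: mult.assoc)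
  ultimately show ?thesis using that ij(3) by blast
qed

text \<open>Equality of characters implies equivalence. While \<open>X Y\<close> is not the identity, a nonzero intertwiner \<open>K\<close> between the
  complements and an equivariant inverse \<open>L\<close> of it extend the pair to \<open>(X + K, Y + L)\<close>, and
  \<open>tr (X Y)\<close> grows by the trace of the nonzero projection \<open>K L\<close>.\<close>

theorem invertible_intertwiner_exists:
  "\<exists>X Y. intertwines X \<and> shape n n Y \<and> X * Y = idm n \<and> Y * X = idm n"
proof -
  let ?Q = "\<lambda>(X, Y). intertwines X \<and> intertwines (tpose Y) \<and> X * Y * X = X \<and> Y * X * Y = Y \<and>
    tpose (X * Y) = X * Y"
  have "\<exists>Z. ?Q Z \<and> fst Z * snd Z = idm n"
  proof (rule bounded_ascent[where f = "\<lambda>Z. trace (fst Z * snd Z)" and b = "real n"])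
    show "?Q (0, 0)" by (simp add: intertwines_def)
  next
    fix Z assume "?Q Z"
    then obtain X Y where Z: "Z = (X, Y)" and XY: "?Q (X, Y)" by (cases Z) auto
    have sh: "shape n n (X * Y)"
      using XY shape_tpose[of n n "tpose Y"] by (auto simp: intertwines_def)
    have "X * Y * (X * Y) = X * Y" using XY by (simp add: mult.assoc)
    then have "0 \<le> trace (idm n - X * Y)"
      using XY by (intro trace_symmetric_idempotent)
        (simp_all add: tpose_diff left_diff_distrib right_diff_distrib idm_mult[OF sh] mult_idm[OF sh]
          idm_mult[OF shape_idm])
    then show "trace (fst Z * snd Z) \<le> real n" by (simp add: Z trace_diff)
  next
    fix Z assume "?Q Z" and ne: "fst Z * snd Z \<noteq> idm n"
    then obtain X Y where Z: "Z = (X, Y)" and XY: "?Q (X, Y)" by (cases Z) auto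
    then have X: "intertwines X" and Y: "intertwines (tpose Y)" and XYX: "X * Y * X = X"
      and YXY: "Y * X * Y = Y" and sym: "tpose (X * Y) = X * Y" by auto
    obtain K where K: "intertwines K" "K \<noteq> 0" "Y * K = 0" "K * Y = 0"
      using intertwiner_between_complements[OF X Y XYX YXY sym] ne unfolding Z by auto
    obtain L1 where L1: "intertwines (tpose L1)" "K * L1 * K = K" "tpose (K * L1) = K * L1"
      by (rule equivariant_least_squares_inverse[OF K(1)])
    \<comment> \<open>\<open>L1 K L1\<close> is a reflexive inverse of \<open>K\<close>; the factor \<open>P'\<close> gives \<open>X L = 0\<close>.\<close>
    define P' where "P' = idm n - Y * X"
    define L where "L = P' * L1 * (K * L1)"
    have shape: "shape n n X" "shape n n Y" "shape n n K" "shape n n L1"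
      using X Y K L1 shape_tpose[of n n "tpose Y"] shape_tpose[of n n "tpose L1"]
      by (auto simp: intertwines_def)
    then have shape': "shape n n P'" "shape n n L" by (auto simp: P'_def L_def)
    have XP: "X * P' = 0"
      using XYX shape by (simp add: P'_def right_diff_distrib mult.assoc)
    have KP: "K * P' = K"
      using K(4) shape by (simp add: P'_def right_diff_distrib mult.assoc[symmetric])
    have XL: "X * L = 0" by (simp add: L_def mult.assoc[symmetric] XP)
    have KL: "K * L = K * L1"
    proof -
      have "K * L = K * L1 * K * L1" by (simp add: L_def mult.assoc[symmetric] KP)
      then show ?thesis by (simp add: L1)
    qed
    have "tpose X * K = tpose (X * Y * X) * K" using XYX by simp
    also have "\<dots> = tpose X * (X * Y) * K"
      using sym by (simp add: tpose_mult[of "X * Y" X])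
    finally have "tpose X * K = 0" using K(3) by (simp add: mult.assoc)
    then have "tpose (K * L1 * X) = 0"
      using L1(3) by (simp add: tpose_mult[of "K * L1" X] mult.assoc[symmetric])
    then have KL1X: "K * L1 * X = 0" by (metis tpose_tpose tpose_zero)
    have LX: "L * X = 0" by (simp add: L_def mult.assoc[of _ "K * L1"] KL1X)
    have LKL: "L * (K * L) = L"
    proof -
      have "L * (K * L) = P' * L1 * (K * L1 * K * L1)" unfolding KL by (simp add: L_def mult.assoc)
      then show ?thesis by (simp add: L1 L_def)
    qed
    have KLK: "K * L * K = K" and symKL: "tpose (K * L) = K * L" by (simp_all add: KL L1)
    have "y * L = L * x" if xy: "(x, y) \<in> \<Gamma>" for x y
    proof -
      have xX: "x * X = X * y" "x * K = K * y" using X K xy unfolding intertwines_def by auto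
      note yY = intertwines_tpose[OF Y xy] intertwines_tpose[OF L1(1) xy]
      have "y * (Y * X) = Y * X * y" using xX yY by (metis mult.assoc)
      then have "y * P' = P' * y" using shapes[OF xy] by (simp add: P'_def commute_complement)
      then have "y * L = P' * (y * L1) * (K * L1)" by (simp add: L_def mult.assoc[symmetric])
      also have "\<dots> = P' * L1 * (x * K) * L1" by (simp add: yY mult.assoc)
      also have "\<dots> = P' * L1 * K * (y * L1)" by (simp add: xX mult.assoc)
      finally show ?thesis by (simp add: yY L_def mult.assoc)
    qed
    then have "tpose x * tpose L = tpose L * tpose y" if "(x, y) \<in> \<Gamma>" for x y
      using that by (metis tpose_mult)
    then have "x * tpose L = tpose L * y" if "(x, y) \<in> \<Gamma>" for x y
      using inverse[OF that] by (metis tpose_tpose)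
    then have L: "intertwines (tpose L)" using shape' by (auto simp: intertwines_def)
    have prod: "(X + K) * (Y + L) = X * Y + K * L"
      by (simp add: algebra_simps XL K)
    have "intertwines (X + K)" "intertwines (tpose (Y + L))"
      using intertwines_add[OF X K(1)] intertwines_add[OF Y L] by (simp_all add: tpose_add)
    moreover have "(X + K) * (Y + L) * (X + K) = X + K"
      using KLK XYX K(3) LX unfolding prod by (simp add: algebra_simps)
    moreover have "(Y + L) * (X + K) * (Y + L) = Y + L"
      using LKL YXY mult_extend_right[OF K(3), of L] mult_extend_right[OF LX, of Y]
      unfolding mult.assoc prod by (simp add: algebra_simps)
    moreover have "tpose ((X + K) * (Y + L)) = (X + K) * (Y + L)"
      unfolding prod by (simp add: tpose_add sym symKL)
    ultimately have "?Q (X + K, Y + L)" by simp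
    moreover have "1 \<le> trace (K * L)"
    proof (rule trace_symmetric_idempotent_ge_1[OF symKL])
      show "K * L * (K * L) = K * L" using LKL by (simp add: mult.assoc)
      show "K * L \<noteq> 0" using KLK \<open>K \<noteq> 0\<close> by auto
    qed
    ultimately show "\<exists>W. ?Q W \<and> trace (fst Z * snd Z) + 1 \<le> trace (fst W * snd W)"
      by (intro exI[of _ "(X + K, Y + L)"]) (simp add: Z prod trace_add)
  qed
  then obtain X Y where X: "intertwines X" and Y: "intertwines (tpose Y)" and XY: "X * Y = idm n"
    by auto
  have "shape n n X" "shape n n Y"
    using X Y shape_tpose[of n n "tpose Y"] by (auto simp: intertwines_def)
  then show ?thesis using X XY right_inverse_imp_left_inverse by blast
qed

end

section \<open>Products of matrices and similarity\<close>

definition word :: "nat \<Rightarrow> ('c \<Rightarrow> fmat) \<Rightarrow> 'c list \<Rightarrow> fmat" where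
  "word m a cs = foldr (\<lambda>c M. a c * M) cs (idm m)"

lemma word_Nil [simp]: "word m a [] = idm m"
  and word_Cons [simp]: "word m a (c # cs) = a c * word m a cs"
  by (simp_all add: word_def)

lemma shape_word: "(\<And>c. c \<in> set cs \<Longrightarrow> shape m m (a c)) \<Longrightarrow> shape m m (word m a cs)"
  by (induction cs) auto

lemma word_append:
  assumes "\<And>c. c \<in> set ds \<Longrightarrow> shape m m (a c)"
  shows "word m a (cs @ ds) = word m a cs * word m a ds"
  using shape_word[of ds m a, OF assms] by (induction cs) (simp_all add: mult.assoc)

lemma trace_word_rotate:
  assumes "\<And>c. c \<in> set cs \<union> set ds \<Longrightarrow> shape m m (a c)"
  shows "trace (word m a (cs @ ds)) = trace (word m a (ds @ cs))"
  using assms by (simp add: word_append trace_comm)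

text \<open>The condition \<open>a c * T = T * a' c\<close> is used in place of \<open>a c = T * a' c * S\<close> because it is linear in \<open>T\<close>.\<close>

definition similar_by :: "nat \<Rightarrow> 'c set \<Rightarrow> ('c \<Rightarrow> fmat) \<Rightarrow> ('c \<Rightarrow> fmat) \<Rightarrow> fmat \<Rightarrow> fmat \<Rightarrow> bool" where
  "similar_by m C a a' T S \<longleftrightarrow> shape m m T \<and> shape m m S \<and> T * S = idm m \<and> S * T = idm m \<and>
     (\<forall>c\<in>C. a c * T = T * a' c)"

lemma similar_byD:
  assumes "similar_by m C a a' T S"
  shows "shape m m T" "shape m m S" "T * S = idm m" "S * T = idm m"
    "\<And>c. c \<in> C \<Longrightarrow> a c * T = T * a' c"
  using assms unfolding similar_by_def by auto

lemma similar_by_trace_word: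
  assumes sim: "similar_by m C a a' T S" and "set cs \<subseteq> C"
    and sh: "\<And>c. c \<in> C \<Longrightarrow> shape m m (a c)" "\<And>c. c \<in> C \<Longrightarrow> shape m m (a' c)"
  shows "trace (word m a cs) = trace (word m a' cs)"
proof -
  note T = similar_byD[OF sim]
  have comm: "word m a cs * T = T * word m a' cs" using \<open>set cs \<subseteq> C\<close>
  proof (induction cs)
    case (Cons c cs)
    then have "word m a (c # cs) * T = a c * T * word m a' cs" by (simp add: mult.assoc)
    then show ?case using Cons mult_extend_right[OF T(5)[of c]] by (simp add: mult.assoc)
  qed (use T(1) in simp)
  have "shape m m (word m a cs)" "shape m m (word m a' cs)"
    using assms by (auto intro!: shape_word)
  then have "trace (word m a cs) = trace (word m a cs * T * S)"
    using T by (simp add: mult.assoc)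
  also have "\<dots> = trace (S * T * word m a' cs)"
    unfolding comm trace_comm[of "T * word m a' cs" S] by (simp add: mult.assoc)
  finally show ?thesis using T \<open>shape m m (word m a' cs)\<close> by simp
qed

lemma of_mat_word:
  assumes "\<And>c. c \<in> set cs \<Longrightarrow> A c \<in> carrier_mat m m"
  shows "mat_word m A cs \<in> carrier_mat m m \<and> of_mat (mat_word m A cs) = word m (\<lambda>c. of_mat (A c)) cs"
  using assms
proof (induction cs)
  case (Cons c cs)
  then have IH: "mat_word m A cs \<in> carrier_mat m m"
    "of_mat (mat_word m A cs) = word m (\<lambda>c. of_mat (A c)) cs" and c: "A c \<in> carrier_mat m m"
    by auto
  have "mat_word m A (c # cs) = A c * mat_word m A cs" by (simp add: mat_word_def)
  then show ?case using mult_carrier_mat[OF c IH(1)] of_mat_mult[OF c IH(1)] IH(2) by simp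
qed (simp add: mat_word_def)

lemma cycle_equivalent_iff:
  assumes "\<And>c. c \<in> C \<Longrightarrow> A c \<in> carrier_mat m m" "\<And>c. c \<in> C \<Longrightarrow> A' c \<in> carrier_mat m m"
  shows "cycle_equivalent m C A A' \<longleftrightarrow> (\<forall>cs. set cs \<subseteq> C \<longrightarrow>
    trace (word m (\<lambda>c. of_mat (A c)) cs) = trace (word m (\<lambda>c. of_mat (A' c)) cs))"
proof -
  have "mat_trace (mat_word m A cs) = trace (word m (\<lambda>c. of_mat (A c)) cs)"
    "mat_trace (mat_word m A' cs) = trace (word m (\<lambda>c. of_mat (A' c)) cs)" if "set cs \<subseteq> C" for cs
    using of_mat_word[of cs A m] of_mat_word[of cs A' m] assms that
    by (auto simp: mat_trace_eq_trace subset_iff)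
  then show ?thesis by (simp add: cycle_equivalent_def)
qed

lemma transplantable_imp_similar:
  assumes "\<And>c. c \<in> C \<Longrightarrow> A c \<in> carrier_mat m m" "\<And>c. c \<in> C \<Longrightarrow> A' c \<in> carrier_mat m m"
    and "transplantable m C A A'"
  obtains T S where "similar_by m C (\<lambda>c. of_mat (A c)) (\<lambda>c. of_mat (A' c)) T S"
proof -
  obtain T S where T: "T \<in> carrier_mat m m" and S: "S \<in> carrier_mat m m"
    and inv: "T * S = 1\<^sub>m m" "S * T = 1\<^sub>m m" and AT: "\<And>c. c \<in> C \<Longrightarrow> A c = T * A' c * S"
    using assms(3) by (auto simp: transplantable_def transplantation_matrix_def inverts_mat_def)
  have "of_mat (A c) * of_mat T = of_mat T * of_mat (A' c)" if c: "c \<in> C" for c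
  proof -
    have "of_mat (A c) = of_mat T * of_mat (A' c) * of_mat S"
      unfolding AT[OF c] of_mat_mult[OF mult_carrier_mat[OF T assms(2)[OF c]] S]
        of_mat_mult[OF T assms(2)[OF c]] ..
    then show ?thesis
      using of_mat_mult[OF S T] inv(2) mult_idm[OF shape_of_mat[OF assms(2)[OF c]]]
      by (simp add: mult.assoc)
  qed
  then have "similar_by m C (\<lambda>c. of_mat (A c)) (\<lambda>c. of_mat (A' c)) (of_mat T) (of_mat S)"
    using of_mat_mult[OF S T] of_mat_mult[OF T S] inv T S
    by (auto simp: similar_by_def shape_of_mat)
  then show ?thesis by (rule that)
qed

lemma transplantable_imp_cycle_equivalent:
  assumes A: "\<And>c. c \<in> C \<Longrightarrow> A c \<in> carrier_mat m m" "\<And>c. c \<in> C \<Longrightarrow> A' c \<in> carrier_mat m m"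
    and "transplantable m C A A'"
  shows "cycle_equivalent m C A A'"
proof -
  obtain T S where sim: "similar_by m C (\<lambda>c. of_mat (A c)) (\<lambda>c. of_mat (A' c)) T S"
    by (rule transplantable_imp_similar[OF A assms(3)])
  have "trace (word m (\<lambda>c. of_mat (A c)) cs) = trace (word m (\<lambda>c. of_mat (A' c)) cs)"
    if "set cs \<subseteq> C" for cs
    by (rule similar_by_trace_word[OF sim that]) (simp_all add: A shape_of_mat)
  then show ?thesis using A by (simp add: cycle_equivalent_iff)
qed

lemma similar_imp_transplantation_matrix:
  assumes A: "\<And>c. c \<in> C \<Longrightarrow> A c \<in> carrier_mat m m" "\<And>c. c \<in> C \<Longrightarrow> A' c \<in> carrier_mat m m"
    and sim: "similar_by m C (\<lambda>c. of_mat (A c)) (\<lambda>c. of_mat (A' c)) T S"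
  shows "transplantation_matrix m C A A' (to_mat m m T)"
proof -
  let ?T = "to_mat m m T" and ?S = "to_mat m m S"
  note T = similar_byD[OF sim]
  note carr = to_mat_carrier[of m m T] to_mat_carrier[of m m S]
  have "?T * ?S = 1\<^sub>m m"
    by (rule of_mat_inj[OF mult_carrier_mat[OF carr(1,2)] one_carrier_mat])
      (simp add: of_mat_mult[OF carr(1,2)] T)
  moreover have "?S * ?T = 1\<^sub>m m"
    by (rule of_mat_inj[OF mult_carrier_mat[OF carr(2,1)] one_carrier_mat])
      (simp add: of_mat_mult[OF carr(2,1)] T)
  moreover have "A c = ?T * A' c * ?S" if c: "c \<in> C" for c
  proof (rule of_mat_inj[OF A(1)[OF c]])
    note TA = mult_carrier_mat[OF carr(1) A(2)[OF c]]
    show "?T * A' c * ?S \<in> carrier_mat m m" by (rule mult_carrier_mat[OF TA carr(2)])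
    have "of_mat (?T * A' c * ?S) = of_mat (A c) * (T * S)"
      using T(1,2) T(5)[OF c]
      by (simp add: of_mat_mult[OF TA carr(2)] of_mat_mult[OF carr(1) A(2)[OF c]] mult.assoc[symmetric])
    then show "of_mat (A c) = of_mat (?T * A' c * ?S)"
      using mult_idm[OF shape_of_mat[OF A(1)[OF c]]] T(3) by simp
  qed
  ultimately show ?thesis
    using carr carrier_matD(1)[OF carr(1)] carrier_matD(1)[OF carr(2)]
    unfolding transplantation_matrix_def inverts_mat_def by (auto intro!: bexI[of _ ?S])
qed

section \<open>Symmetric signed permutation matrices\<close>

text \<open>Zero rows are admitted because only \<open>n\<close> of the infinitely many rows of a finitely supported matrix
  can be nonzero. Such matrices are closed under products and form a finite set, which is the reason why
  the adjacency matrices generate a finite group.\<close>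

definition signed_rows :: "nat \<Rightarrow> fmat \<Rightarrow> bool" where
  "signed_rows n A \<longleftrightarrow> shape n n A \<and>
     (\<forall>i. \<exists>w s. s \<in> {-1, 0, 1} \<and> (\<forall>j. entry A i j = (if j = w then s else 0)))"

lemma signed_rows_idm: "signed_rows n (idm n)"
  unfolding signed_rows_def
proof (intro conjI allI)
  fix i
  show "\<exists>w s. s \<in> {-1, 0, 1} \<and> (\<forall>j. entry (idm n) i j = (if j = w then s else 0))"
    by (rule exI[of _ i], rule exI[of _ "if i < n then 1 else 0"]) (auto simp: entry_idm)
qed simp

lemma signed_rows_mult:
  assumes A: "signed_rows n A" and B: "signed_rows n B"
  shows "signed_rows n (A * B)"
  unfolding signed_rows_def
proof (intro conjI allI)
  show "shape n n (A * B)" using A B by (auto simp: signed_rows_def)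
  fix i
  obtain w s where s: "s \<in> {-1, 0, 1}" "\<And>j. entry A i j = (if j = w then s else 0)"
    using A unfolding signed_rows_def by meson
  obtain w' s' where s': "s' \<in> {-1, 0, 1}" "\<And>j. entry B w j = (if j = w' then s' else 0)"
    using B unfolding signed_rows_def by meson
  have shA: "shape n n A" and shB: "shape n n B" using A B by (auto simp: signed_rows_def)
  have "entry (A * B) i j = s * entry B w j" for j
    using shapeD[OF shB, of w j] by (cases "w < n") (auto simp: entry_mult[OF shA] s(2)
        if_distrib[of "\<lambda>x. x * _"] cong: if_cong)
  then show "\<exists>w s. s \<in> {-1, 0, 1} \<and> (\<forall>j. entry (A * B) i j = (if j = w then s else 0))"
    using s(1) s' by (intro exI[of _ w'] exI[of _ "s * s'"]) auto
qed

lemma finite_signed_rows: "finite {A. signed_rows n A}"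
proof (rule finite_subset)
  let ?F = "PiE ({..<n} \<times> {..<n}) (\<lambda>_. {-1, 0, 1 :: real})"
  show "{A. signed_rows n A} \<subseteq> (\<lambda>f. fmat_of n n (\<lambda>i j. f (i, j))) ` ?F"
  proof
    fix A assume "A \<in> {A. signed_rows n A}"
    then have A: "signed_rows n A" by simp
    then have sh: "shape n n A" by (simp add: signed_rows_def)
    have "entry A i j \<in> {-1, 0, 1}" for i j
    proof -
      obtain w s where "s \<in> {-1, 0, 1}" "\<And>j. entry A i j = (if j = w then s else 0)"
        using A unfolding signed_rows_def by meson
      then show ?thesis by simp
    qed
    then have "restrict (\<lambda>(i, j). entry A i j) ({..<n} \<times> {..<n}) \<in> ?F" by (auto simp: PiE_iff)
    moreover have "A = fmat_of n n (\<lambda>i j. restrict (\<lambda>(i, j). entry A i j) ({..<n} \<times> {..<n}) (i, j))"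
      using sh by (intro fmat_eqI) (auto simp: entry_fmat_of shapeD)
    ultimately show "A \<in> (\<lambda>f. fmat_of n n (\<lambda>i j. f (i, j))) ` ?F" by blast
  qed
qed (simp add: finite_PiE)

text \<open>The group consists of the pairs of words in the two families. Reversing a word transposes it and also
  inverts it, so the words are orthogonal and closed under inverses.\<close>

lemma signed_involutions_similar:
  assumes a: "\<And>c. c \<in> C \<Longrightarrow> signed_rows n (a c) \<and> tpose (a c) = a c \<and> a c * a c = idm n"
    and a': "\<And>c. c \<in> C \<Longrightarrow> signed_rows n (a' c) \<and> tpose (a' c) = a' c \<and> a' c * a' c = idm n"
    and tr: "\<And>cs. set cs \<subseteq> C \<Longrightarrow> trace (word n a cs) = trace (word n a' cs)"
  shows "\<exists>T S. similar_by n C a a' T S"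
proof -
  define \<Gamma> where "\<Gamma> = (\<lambda>cs. (word n a cs, word n a' cs)) ` {cs. set cs \<subseteq> C}"
  have facts: "signed_rows n (word n f cs) \<and> shape n n (word n f cs) \<and>
      tpose (word n f cs) = word n f (rev cs) \<and> tpose (word n f cs) * word n f cs = idm n"
    if "set cs \<subseteq> C"
      and f: "\<And>c. c \<in> C \<Longrightarrow> signed_rows n (f c) \<and> tpose (f c) = f c \<and> f c * f c = idm n"
    for f and cs
    using that(1)
  proof (induction cs)
    case Nil
    then show ?case by (simp add: signed_rows_idm idm_mult[OF shape_idm])
  next
    case (Cons c cs)
    then have c: "signed_rows n (f c)" "tpose (f c) = f c" "f c * f c = idm n"
      and shf: "shape n n (f c)" using f[of c] by (auto simp: signed_rows_def)
    have IH: "signed_rows n (word n f cs)" "shape n n (word n f cs)"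
      "tpose (word n f cs) = word n f (rev cs)" "tpose (word n f cs) * word n f cs = idm n"
      using Cons by auto
    have "signed_rows n (f c * word n f cs)" using c IH signed_rows_mult by blast
    moreover have "tpose (f c * word n f cs) = word n f (rev cs @ [c])"
      using c shf word_append[of "[c]" n f "rev cs"] by (simp add: tpose_mult IH)
    moreover have "word n f (rev cs) * f c * (f c * word n f cs) = idm n"
      using IH(2,4) c by (simp add: mult.assoc mult_extend_right[OF c(3)] IH(3)[symmetric])
    ultimately show ?case
      using c by (simp add: tpose_mult IH(3)) (simp add: signed_rows_def)
  qed
  have app: "word n f (cs @ ds) = word n f cs * word n f ds" if "set ds \<subseteq> C"
    "\<And>c. c \<in> C \<Longrightarrow> signed_rows n (f c) \<and> tpose (f c) = f c \<and> f c * f c = idm n" for f cs ds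
    using that by (intro word_append) (auto simp: signed_rows_def)
  interpret equal_trace_group n \<Gamma>
  proof
    have "\<Gamma> \<subseteq> {A. signed_rows n A} \<times> {A. signed_rows n A}"
      using facts a a' by (auto simp: \<Gamma>_def)
    then show "finite \<Gamma>" by (rule finite_subset) (simp add: finite_signed_rows)
    show "(idm n, idm n) \<in> \<Gamma>" unfolding \<Gamma>_def by (rule image_eqI[of _ _ "[]"]) auto
    fix x y assume "(x, y) \<in> \<Gamma>"
    then obtain cs where cs: "set cs \<subseteq> C" "x = word n a cs" "y = word n a' cs"
      by (auto simp: \<Gamma>_def)
    note fa = facts[where f = a, OF cs(1) a, folded cs(2)] facts[where f = a', OF cs(1) a', folded cs(3)]
    show "(tpose x, tpose y) \<in> \<Gamma>"
      using fa cs unfolding \<Gamma>_def by (intro image_eqI[of _ _ "rev cs"]) auto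
    show "shape n n x \<and> shape n n y" "tpose x * x = idm n \<and> tpose y * y = idm n" using fa by auto
    show "trace x = trace y" using cs tr by simp
    fix u v assume "(u, v) \<in> \<Gamma>"
    then obtain ds where ds: "set ds \<subseteq> C" "u = word n a ds" "v = word n a' ds"
      by (auto simp: \<Gamma>_def)
    show "(x * u, y * v) \<in> \<Gamma>"
      using cs ds app[where f = a, OF ds(1) a] app[where f = a', OF ds(1) a']
      unfolding \<Gamma>_def by (intro image_eqI[of _ _ "cs @ ds"]) auto
  qed
  obtain T S where T: "intertwines T" "shape n n S" "T * S = idm n" "S * T = idm n"
    using invertible_intertwiner_exists by blast
  have "a c * T = T * a' c" if "c \<in> C" for c
  proof -
    have "(word n a [c], word n a' [c]) \<in> \<Gamma>"
      unfolding \<Gamma>_def using that by (intro imageI) simp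
    moreover have "shape n n (a c)" "shape n n (a' c)" using a a' that by (auto simp: signed_rows_def)
    ultimately show ?thesis using T(1) by (auto simp: intertwines_def)
  qed
  then show ?thesis using T by (auto simp: similar_by_def intertwines_def)
qed

section \<open>Lifting a similarity from vertices to edges\<close>

text \<open>Rows of \<open>X\<close> and columns of \<open>Y\<close> are indexed by edges, and \<open>p c\<close> projects onto the edges of color \<open>c\<close>. The
  last assumption says that an edge meets itself in weight 2 and meets no other edge of its color.\<close>

locale colored_factorization =
  fixes C :: "'c set" and n m :: nat and p :: "'c \<Rightarrow> fmat" and X Y :: fmat
  assumes finite_C: "finite C"
    and shape_X: "shape m n X" and shape_Y: "shape n m Y"
    and shape_p: "c \<in> C \<Longrightarrow> shape m m (p c)"
    and p_idem: "c \<in> C \<Longrightarrow> p c * p c = p c"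
    and p_orth: "c \<in> C \<Longrightarrow> d \<in> C \<Longrightarrow> c \<noteq> d \<Longrightarrow> p c * p d = 0"
    and p_sum: "(\<Sum>c\<in>C. p c) = idm m"
    and p_XY_p: "c \<in> C \<Longrightarrow> p c * (X * Y) * p c = 2 *\<^sub>R p c"
begin

text \<open>For a graph, \<open>b c\<close> is \<open>I + A\<^sup>c\<close>, see \<open>b_eq_adj\<close>, and \<open>vc c\<close> is the matrix of the vertex-colored line
  graph, see \<open>vc_eq_vc_line_adj\<close>.\<close>

definition b :: "'c \<Rightarrow> fmat" where "b c = Y * p c * X"

definition vc :: "'c \<Rightarrow> fmat" where "vc c = p c * (X * Y - 2 *\<^sub>R idm m)"

lemma shape_XY: "shape m m (X * Y)"
  using shape_X shape_Y by blast

lemma shape_b: "c \<in> C \<Longrightarrow> shape n n (b c)"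
  using shape_X shape_Y shape_p by (auto simp: b_def)

lemma b_b: "c \<in> C \<Longrightarrow> b c * b c = 2 *\<^sub>R b c"
proof -
  assume c: "c \<in> C"
  have "b c * b c = Y * (p c * (X * Y) * p c) * X" by (simp add: b_def mult.assoc)
  then show ?thesis by (simp add: p_XY_p[OF c] b_def)
qed

lemma p_mult_sum:
  assumes "c \<in> C"
  shows "p c * (\<Sum>d\<in>C. p d * Z d) = p c * Z c"
proof -
  have "p c * (\<Sum>d\<in>C. p d * Z d) = (\<Sum>d\<in>C. if d = c then p c * Z c else 0)"
    unfolding sum_distrib_left using assms
    by (intro sum.cong) (auto simp: mult.assoc[symmetric] p_idem p_orth)
  then show ?thesis using assms finite_C by simp
qed

lemma sum_mult_p:
  assumes "c \<in> C"
  shows "(\<Sum>d\<in>C. Z d * p d) * p c = Z c * p c"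
proof -
  have "(\<Sum>d\<in>C. Z d * p d) * p c = (\<Sum>d\<in>C. if d = c then Z c * p c else 0)"
    unfolding sum_distrib_right using assms
    by (intro sum.cong) (auto simp: mult.assoc p_idem p_orth)
  then show ?thesis using assms finite_C by simp
qed

lemma eq_by_blocks:
  assumes "shape m q Z" "shape m q Z'" "\<And>c. c \<in> C \<Longrightarrow> p c * Z = p c * Z'"
  shows "Z = Z'"
proof -
  have "Z = (\<Sum>c\<in>C. p c) * Z" using assms(1) by (simp add: p_sum)
  also have "\<dots> = (\<Sum>c\<in>C. p c) * Z'" unfolding sum_distrib_right using assms(3) by simp
  finally show ?thesis using assms(2) by (simp add: p_sum)
qed

end

locale colored_factorization_pair =
  G: colored_factorization C n m p X Y + G': colored_factorization C n m p X' Y'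
  for C :: "'c set" and n m p X Y X' Y'
begin

text \<open>The transplantation matrix of the line graphs: \<open>X T Y'\<close> restricted to its diagonal color blocks. The
  factor 1/2 compensates \<open>p c * (X * Y) * p c = 2 *\<^sub>R p c\<close>.\<close>

definition lift :: "fmat \<Rightarrow> fmat" where
  "lift T = (1 / 2) *\<^sub>R (\<Sum>c\<in>C. p c * (X * T * Y') * p c)"

lemma shape_lift:
  assumes "shape n n T" shows "shape m m (lift T)"
proof -
  have "shape m m (X * T * Y')" using assms G.shape_X G'.shape_Y by blast
  then show ?thesis unfolding lift_def using G.shape_p by blast
qed

lemma p_lift: "c \<in> C \<Longrightarrow> p c * lift T = (1 / 2) *\<^sub>R (p c * (X * T * Y') * p c)"
  using G.p_mult_sum[of c "\<lambda>d. X * T * Y' * p d"] by (simp add: lift_def mult.assoc)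

lemma lift_p: "c \<in> C \<Longrightarrow> lift T * p c = (1 / 2) *\<^sub>R (p c * (X * T * Y') * p c)"
  using G.sum_mult_p[of c "\<lambda>d. p d * (X * T * Y')"] by (simp add: lift_def)

lemma lift_commutes_p: "c \<in> C \<Longrightarrow> p c * lift T = lift T * p c"
  by (simp add: p_lift lift_p)

text \<open>Both sides equal \<open>X T Y'\<close>. On the block of rows of color \<open>c\<close>, moving \<open>T\<close> past \<open>b c\<close> produces a factor
  \<open>p c * (X * Y) * p c = 2 *\<^sub>R p c\<close>, which cancels the 1/2 in \<open>lift\<close>; the columns are treated in the same way.\<close>

lemma lift_intertwines:
  assumes T: "shape n n T" and bT: "\<And>c. c \<in> C \<Longrightarrow> G.b c * T = T * G'.b c"
  shows "X * Y * lift T = lift T * (X' * Y')"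
proof -
  have "lift T * (X' * Y') = X * T * Y'"
  proof (rule G.eq_by_blocks)
    show "shape m m (lift T * (X' * Y'))" "shape m m (X * T * Y')"
      using shape_lift[OF T] T G.shape_X G'.shape_Y G'.shape_XY by blast+
    fix c assume c: "c \<in> C"
    have "p c * (lift T * (X' * Y')) = (1 / 2) *\<^sub>R (p c * X * (T * G'.b c) * Y')"
      by (simp add: mult.assoc[symmetric] p_lift[OF c, of T]) (simp add: G'.b_def mult.assoc)
    also have "\<dots> = (1 / 2) *\<^sub>R (p c * (X * Y) * p c * X * T * Y')"
      by (simp add: bT[OF c, symmetric]) (simp add: G.b_def mult.assoc)
    finally show "p c * (lift T * (X' * Y')) = p c * (X * T * Y')"
      unfolding G.p_XY_p[OF c] by (simp add: mult.assoc)
  qed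
  moreover have "X * Y * lift T = X * T * Y'"
  proof -
    have "X * Y * lift T = X * Y * lift T * (\<Sum>c\<in>C. p c)"
      using mult_idm[OF shape_mult[OF G.shape_XY shape_lift[OF T]]] by (simp add: G.p_sum)
    also have "\<dots> = (\<Sum>c\<in>C. X * T * Y' * p c)"
      unfolding sum_distrib_left
    proof (rule sum.cong)
      fix c assume c: "c \<in> C"
      have "X * Y * lift T * p c = (1 / 2) *\<^sub>R (X * (G.b c * T) * Y' * p c)"
        by (simp add: mult.assoc lift_p[OF c]) (simp add: G.b_def mult.assoc)
      also have "\<dots> = (1 / 2) *\<^sub>R (X * T * Y' * (p c * (X' * Y') * p c))"
        by (simp add: bT[OF c]) (simp add: G'.b_def mult.assoc)
      finally show "X * Y * lift T * p c = X * T * Y' * p c"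
        by (simp add: G'.p_XY_p[OF c])
    qed simp
    also have "\<dots> = X * T * Y' * (\<Sum>c\<in>C. p c)" by (simp add: sum_distrib_left)
    also have "\<dots> = X * T * Y'"
      using mult_idm[OF shape_mult[OF shape_mult[OF G.shape_X T] G'.shape_Y]] by (simp add: G.p_sum)
    finally show ?thesis .
  qed
  ultimately show ?thesis by simp
qed

end

lemma lift_inverse:
  assumes "colored_factorization_pair C n m p X Y X' Y'"
    and T: "shape n n T" "shape n n S" "T * S = idm n"
    and bT: "\<And>c. c \<in> C \<Longrightarrow> colored_factorization.b p X Y c * T = T * colored_factorization.b p X' Y' c"
  shows "colored_factorization_pair.lift C p X Y' T * colored_factorization_pair.lift C p X' Y S = idm m"
proof -
  interpret colored_factorization_pair C n m p X Y X' Y' by fact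
  interpret R: colored_factorization_pair C n m p X' Y' X Y by unfold_locales
  show ?thesis
  proof (rule G.eq_by_blocks)
    show "shape m m (lift T * R.lift S)" using shape_lift R.shape_lift T by blast
    fix c assume c: "c \<in> C"
    have "p c * (lift T * R.lift S) = (1 / 2) *\<^sub>R (p c * (X * T * Y') * (p c * R.lift S))"
      by (simp add: mult.assoc[symmetric] p_lift[OF c])
    also have "\<dots> = (1 / 4) *\<^sub>R (p c * X * (T * G'.b c) * S * Y * p c)"
      by (simp add: R.p_lift[OF c]) (simp add: G'.b_def mult.assoc)
    also have "\<dots> = (1 / 4) *\<^sub>R (p c * X * G.b c * (T * S) * Y * p c)"
      by (simp add: bT[OF c, symmetric] mult.assoc)
    also have "\<dots> = (1 / 4) *\<^sub>R (p c * (X * Y) * p c * (X * Y) * p c)"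
      using T(3) G.shape_Y by (simp add: G.b_def mult.assoc)
    also have "\<dots> = p c"
      by (simp add: G.p_XY_p[OF c])
    finally show "p c * (lift T * R.lift S) = p c * idm m" using G.shape_p[OF c] by simp
  qed simp
qed

context colored_factorization_pair
begin

lemma lift_similar:
  assumes sim: "similar_by n C G.b G'.b T S"
  obtains S' where "similar_by m C G.vc G'.vc (lift T) S'"
    "X * Y * lift T = lift T * (X' * Y')"
proof -
  interpret R: colored_factorization_pair C n m p X' Y' X Y by unfold_locales
  note T = similar_byD[OF sim]
  have bS: "G'.b c * S = S * G.b c" if c: "c \<in> C" for c
  proof -
    have "G'.b c * S = S * (T * G'.b c) * S"
      using T(4) G'.shape_b[OF c] by (simp add: mult.assoc[symmetric])
    also have "\<dots> = S * G.b c * (T * S)" by (simp add: T(5)[OF c, symmetric] mult.assoc)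
    finally show ?thesis using T(3) mult_idm[OF shape_mult[OF T(2) G.shape_b[OF c]]] by simp
  qed
  have inv: "lift T * R.lift S = idm m" "R.lift S * lift T = idm m"
    using lift_inverse[OF colored_factorization_pair_axioms T(1,2,3) T(5)]
      lift_inverse[OF R.colored_factorization_pair_axioms T(2,1,4) bS] by auto
  have W: "X * Y * lift T = lift T * (X' * Y')" by (rule lift_intertwines[OF T(1) T(5)])
  have "G.vc c * lift T = lift T * G'.vc c" if c: "c \<in> C" for c
  proof -
    have sh: "shape m m (lift T)" by (rule shape_lift[OF T(1)])
    have "G.vc c * lift T = p c * (X * Y * lift T - 2 *\<^sub>R lift T)"
      using sh by (simp add: G.vc_def mult.assoc left_diff_distrib)
    also have "\<dots> = p c * lift T * (X' * Y' - 2 *\<^sub>R idm m)"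
      unfolding W using sh by (simp add: mult.assoc right_diff_distrib)
    finally show ?thesis by (simp add: G'.vc_def lift_commutes_p[OF c] mult.assoc)
  qed
  then have "similar_by m C G.vc G'.vc (lift T) (R.lift S)"
    using inv T shape_lift R.shape_lift by (auto simp: similar_by_def)
  then show ?thesis using W that by blast
qed

end

section \<open>Closed walks on the line graph\<close>

text \<open>Expanding one factor \<open>a c = b c - I\<close> at a time expresses the traces of words in \<open>a\<close> through those of
  words in \<open>b\<close>. The induction needs words that start in \<open>b\<close> and end in \<open>a\<close>.\<close>

lemma trace_words_add_identity:
  assumes sh: "\<And>c. c \<in> C \<Longrightarrow> shape n n (a c)" "\<And>c. c \<in> C \<Longrightarrow> shape n n (a' c)"
    and b: "\<And>c. c \<in> C \<Longrightarrow> b c = idm n + a c" "\<And>c. c \<in> C \<Longrightarrow> b' c = idm n + a' c"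
    and tr: "\<And>cs. set cs \<subseteq> C \<Longrightarrow> trace (word n b cs) = trace (word n b' cs)"
    and cs: "set cs \<subseteq> C"
  shows "trace (word n a cs) = trace (word n a' cs)"
proof -
  have shb: "shape n n (b c)" "shape n n (b' c)" if "c \<in> C" for c
    using sh that b by auto
  have "trace (word n b us * word n a cs) = trace (word n b' us * word n a' cs)"
    if "set us \<subseteq> C" for us
    using cs that
  proof (induction cs arbitrary: us)
    case Nil
    then have "shape n n (word n b us)" "shape n n (word n b' us)"
      using shb by (auto intro!: shape_word)
    then show ?case using tr[OF Nil(2)] by simp
  next
    case (Cons c cs)
    then have c: "c \<in> C" and cs: "set cs \<subseteq> C" by auto
    have shw: "shape n n (word n a cs)" "shape n n (word n a' cs)"
      using sh cs by (auto intro!: shape_word)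
    have app: "word n b (us @ [c]) = word n b us * b c" "word n b' (us @ [c]) = word n b' us * b' c"
      using shb[OF c] word_append[of "[c]" n b us] word_append[of "[c]" n b' us] by auto
    have "word n b us * word n a (c # cs) = word n b (us @ [c]) * word n a cs - word n b us * word n a cs"
      "word n b' us * word n a' (c # cs) = word n b' (us @ [c]) * word n a' cs - word n b' us * word n a' cs"
      using shw unfolding app by (simp_all add: b[OF c] algebra_simps)
    then show ?case using Cons.IH[OF cs, of us] Cons.IH[OF cs, of "us @ [c]"] Cons.prems c
      by (simp add: trace_diff)
  qed
  from this[of "[]"] show ?thesis
    using shape_word[of cs n a] shape_word[of cs n a'] sh cs by (auto simp: subset_iff)
qed

lemma repeated_neighbour:
  "\<not> distinct_adj xs \<Longrightarrow> \<exists>us x vs. xs = us @ x # x # vs"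
proof (induction xs)
  case (Cons x xs)
  show ?case
  proof (cases "distinct_adj xs")
    case True
    with Cons.prems have "xs \<noteq> []" "x = hd xs" by (auto simp: distinct_adj_Cons)
    then have "x # xs = [] @ x # x # tl xs" by simp
    then show ?thesis by blast
  next
    case False
    then obtain us y vs where "xs = us @ y # y # vs" using Cons.IH by blast
    then have "x # xs = (x # us) @ y # y # vs" by simp
    then show ?thesis by blast
  qed
qed simp

text \<open>A word with two equal cyclic neighbors can be rotated so that they stand in front, and then
  \<open>b c * b c = r *\<^sub>R b c\<close> shortens it.\<close>

lemma trace_words_by_cyclic_reduction:
  assumes sh: "\<And>c. c \<in> C \<Longrightarrow> shape n n (b c)" "\<And>c. c \<in> C \<Longrightarrow> shape n n (b' c)"
    and sq: "\<And>c. c \<in> C \<Longrightarrow> b c * b c = r *\<^sub>R b c" "\<And>c. c \<in> C \<Longrightarrow> b' c * b' c = r *\<^sub>R b' c"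
    and single: "\<And>c. c \<in> C \<Longrightarrow> trace (b c) = trace (b' c)"
    and reduced: "\<And>c ds. set (c # ds) \<subseteq> C \<Longrightarrow> distinct_adj (c # ds @ [c]) \<Longrightarrow>
      trace (word n b (c # ds)) = trace (word n b' (c # ds))"
    and cs: "set cs \<subseteq> C"
  shows "trace (word n b cs) = trace (word n b' cs)"
  using cs
proof (induction cs rule: length_induct)
  case (1 cs)
  have merge: "trace (word n f (us @ c # c # vs)) = r * trace (word n f (c # vs @ us))"
    if "set (us @ c # c # vs) \<subseteq> C" and f: "\<And>c. c \<in> C \<Longrightarrow> shape n n (f c)" "f c * f c = r *\<^sub>R f c"
    for f us c vs
  proof -
    have "trace (word n f (us @ c # c # vs)) = trace (word n f ((c # c # vs) @ us))"
      using that by (intro trace_word_rotate) auto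
    also have "word n f ((c # c # vs) @ us) = r *\<^sub>R word n f (c # vs @ us)"
      by (simp add: mult_extend_right[OF f(2)])
    finally show ?thesis by (simp only: trace_scaleR)
  qed
  have step: "trace (word n b (us @ c # c # vs)) = trace (word n b' (us @ c # c # vs))"
    if "set (us @ c # c # vs) \<subseteq> C" "length (c # vs @ us) < length cs" for us c vs
  proof -
    have "trace (word n b (c # vs @ us)) = trace (word n b' (c # vs @ us))"
      using 1(1)[rule_format, of "c # vs @ us"] that by auto
    moreover have "c \<in> C" using that by auto
    ultimately show ?thesis
      using merge[OF that(1), of b] merge[OF that(1), of b'] sh sq by simp
  qed
  consider "cs = []" | c where "cs = [c]" | c d ds where "cs = c # d # ds"
    by (metis list.exhaust)
  then show ?case
  proof cases
    case (2 c)
    then have "c \<in> C" using 1(2) by simp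
    then show ?thesis using single 2 mult_idm[OF sh(1)] mult_idm[OF sh(2)] by simp
  next
    case (3 c d ds)
    show ?thesis
    proof (cases "distinct_adj (cs @ [c])")
      case True
      then show ?thesis using reduced[of c "d # ds"] 1(2) 3 by auto
    next
      case False
      then obtain us x vs where eq: "cs @ [c] = us @ x # x # vs"
        using repeated_neighbour by blast
      show ?thesis
      proof (cases vs rule: rev_cases)
        case (snoc vs' y)
        then have "cs = us @ x # x # vs'" using eq by auto
        then show ?thesis using step[of us x vs'] 1(2) by auto
      next
        case Nil
        \<comment> \<open>The repetition is between the last and the first letter.\<close>
        then have x: "x = c" "cs = us @ [c]" using eq by auto
        then obtain us' where us: "us = c # us'" using 3 by (cases us) auto
        have sub: "set (c # us') \<union> set [c] \<subseteq> C" using 1(2) x us by auto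
        have "trace (word n b ([] @ c # c # us')) = trace (word n b' ([] @ c # c # us'))"
          using step[of "[]" c us'] sub x us by auto
        moreover have "trace (word n f (us @ [c])) = trace (word n f ([] @ c # c # us'))"
          if "\<And>c. c \<in> C \<Longrightarrow> shape n n (f c)" for f
          using trace_word_rotate[of us "[c]" n f] that sub us by auto
        ultimately show ?thesis using x sh by metis
      qed
    qed
  qed simp
qed

fun steps :: "'a list \<Rightarrow> 'a set list" where
  "steps (x # y # zs) = {x, y} # steps (y # zs)"
| "steps _ = []"

fun alternating :: "'a list \<Rightarrow> bool" where
  "alternating (x # y # z # zs) \<longleftrightarrow> z = x \<and> alternating (y # z # zs)"
| "alternating _ \<longleftrightarrow> True"

context colored_factorization
begin

text \<open>Apart from the diagonal of \<open>X Y\<close>, this counts, with weights, the walks in the line graph that pass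
  successively through vertices of the colors \<open>cs\<close> and then take one more step.\<close>

definition walk :: "'c list \<Rightarrow> fmat" where
  "walk cs = word m (\<lambda>c. p c * (X * Y)) cs"

lemma shape_walk: "set cs \<subseteq> C \<Longrightarrow> shape m m (walk cs)"
  unfolding walk_def using shape_XY shape_p by (intro shape_word) auto

text \<open>Cyclicity of the trace moves the leading \<open>Y\<close> to the end, which shifts the bracketing from \<open>Y p X\<close> to \<open>p X Y\<close>.\<close>

lemma trace_b_word:
  assumes "set (c # cs) \<subseteq> C"
  shows "trace (word n b (c # cs)) = trace (walk (c # cs))"
proof -
  have comm: "word n b cs * Y = Y * walk cs"
  proof (induction cs)
    case Nil
    then show ?case using shape_Y by (simp add: walk_def)
  next
    case (Cons d cs)
    then show ?case by (simp add: walk_def b_def mult.assoc)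
  qed
  have "trace (word n b (c # cs)) = trace (Y * (p c * X * word n b cs))"
    by (simp add: b_def mult.assoc)
  also have "\<dots> = trace (p c * X * (word n b cs * Y))"
    by (simp only: trace_comm[of Y] mult.assoc)
  also have "\<dots> = trace (walk (c # cs))"
    unfolding comm by (simp add: walk_def mult.assoc)
  finally show ?thesis .
qed

text \<open>The difference between \<open>X Y\<close> and \<open>X Y - 2 I\<close> is invisible between projections onto distinct colors. The
  second conjunct records the color of the first edge, which the induction needs.\<close>

lemma walk_p_vc_word:
  assumes "set (cs @ [d]) \<subseteq> C" "distinct_adj (cs @ [d])"
  shows "walk cs * p d = word m vc cs * p d \<and>
    p (hd (cs @ [d])) * (walk cs * p d) = walk cs * p d"
  using assms
proof (induction cs)
  case Nil
  then have "d \<in> C" by simp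
  then show ?case
    using p_idem[of d] idm_mult[OF shape_p[of d]] by (simp add: walk_def)
next
  case (Cons c cs)
  let ?e = "hd (cs @ [d])" and ?Z = "walk cs * p d"
  have c: "c \<in> C" and e: "?e \<in> C" "c \<noteq> ?e" and "distinct_adj (cs @ [d])"
    using Cons.prems by (auto simp: distinct_adj_Cons hd_append split: if_splits)
  then have IH: "?Z = word m vc cs * p d" "p ?e * ?Z = ?Z" using Cons by auto
  have shZ: "shape m m ?Z" using Cons.prems shape_walk[of cs] shape_p[of d] by auto
  have "p c * ?Z = p c * p ?e * ?Z" using IH(2) by (simp add: mult.assoc)
  then have "p c * ?Z = 0" using p_orth[OF c e] by simp
  then have "vc c * ?Z = p c * (X * Y) * ?Z"
    using shZ by (simp add: vc_def algebra_simps)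
  moreover have "p c * (p c * (X * Y) * ?Z) = p c * (X * Y) * ?Z"
    using p_idem[OF c] by (simp add: mult.assoc[symmetric])
  ultimately show ?case using IH(1) by (simp add: walk_def mult.assoc)
qed

lemma p_walk: "set (c # ds) \<subseteq> C \<Longrightarrow> p c * walk (c # ds) = walk (c # ds)"
  using p_idem[of c] by (simp add: walk_def mult.assoc[symmetric])

lemma trace_walk_p:
  assumes "set (c # ds) \<subseteq> C"
  shows "trace (walk (c # ds) * p c) = trace (walk (c # ds))"
  using p_walk[OF assms] trace_comm[of "walk (c # ds)" "p c"] by simp

lemma trace_walk_vc_word:
  assumes "set (c # ds) \<subseteq> C" "distinct_adj (c # ds @ [c])"
  shows "trace (walk (c # ds)) = trace (word m vc (c # ds))"
proof -
  have c: "c \<in> C" using assms by simp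
  have "trace (walk (c # ds)) = trace (word m vc (c # ds) * p c)"
    using walk_p_vc_word[of "c # ds" c] assms trace_walk_p[OF assms(1)] by simp
  also have "\<dots> = trace (p c * word m vc (c # ds))" by (rule trace_comm)
  also have "p c * word m vc (c # ds) = word m vc (c # ds)"
    using p_idem[OF c] by (simp add: vc_def mult.assoc[symmetric])
  finally show ?thesis .
qed

text \<open>For a graph, the matrix of color \<open>{c, d}\<close> of the edge-colored line graph, see
  \<open>block_eq_ec_line_adj\<close>.\<close>

definition block :: "'c \<Rightarrow> 'c \<Rightarrow> fmat" where
  "block c d = p c * (X * Y) * p d + p d * (X * Y) * p c"

lemma shape_block: "c \<in> C \<Longrightarrow> d \<in> C \<Longrightarrow> shape m m (block c d)"
  unfolding block_def using shape_XY shape_p by blast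

lemma block_commute: "block c d = block d c"
  by (simp add: block_def add.commute)

lemma p_block:
  assumes "c \<in> C" "d \<in> C" "c \<noteq> d"
  shows "p c * block c d = p c * (X * Y) * p d" "block c d * p d = p c * (X * Y) * p d"
  using p_orth[OF assms] p_idem assms
  by (simp_all add: block_def distrib_left distrib_right mult.assoc[symmetric])
     (simp_all add: mult.assoc p_idem p_orth)

lemma p_block_other:
  assumes "c \<in> C" "d \<in> C" "e \<in> C" "e \<noteq> c" "e \<noteq> d"
  shows "p e * block c d = 0"
  using p_orth[of e c] p_orth[of e d] assms
  by (simp add: block_def distrib_left mult.assoc[symmetric])

end

text \<open>Indexing by sets gives the product of edge-colored matrices along a closed sequence of colors as a
  word in \<open>E\<close>.\<close>

locale colored_pair_matrices = colored_factorization C n m p X Y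
  for C :: "'c set" and n m p X Y +
  fixes E :: "'c set \<Rightarrow> fmat"
  assumes E: "c \<in> C \<Longrightarrow> d \<in> C \<Longrightarrow> c \<noteq> d \<Longrightarrow> E {c, d} = block c d"
begin

text \<open>A factor \<open>E {c, d}\<close> leads from color \<open>c\<close> to \<open>d\<close> or back. Fixing the color of the first edge fixes all
  later directions.\<close>

lemma p_E_word:
  assumes "set (cs @ [d]) \<subseteq> C" "distinct_adj (cs @ [d])"
  shows "p (hd (cs @ [d])) * word m E (steps (cs @ [d])) = walk cs * p d"
  using assms
proof (induction cs)
  case Nil
  then have "d \<in> C" by simp
  then show ?case
    using idm_mult[OF shape_p[of d]] mult_idm[OF shape_p[of d]] by (simp add: walk_def)
next
  case (Cons c cs)
  let ?e = "hd (cs @ [d])"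
  have c: "c \<in> C" and e: "?e \<in> C" "c \<noteq> ?e" and "distinct_adj (cs @ [d])"
    using Cons.prems by (auto simp: distinct_adj_Cons hd_append split: if_splits)
  then have IH: "p ?e * word m E (steps (cs @ [d])) = walk cs * p d" using Cons by auto
  have "steps (c # cs @ [d]) = {c, ?e} # steps (cs @ [d])" by (cases cs) auto
  then have "p c * word m E (steps (c # cs @ [d])) =
      p c * block c ?e * word m E (steps (cs @ [d]))"
    using E[OF c e] by (simp add: mult.assoc)
  also have "\<dots> = p c * (X * Y) * (walk cs * p d)"
    unfolding p_block(1)[OF c e] by (simp add: mult.assoc IH)
  finally show ?case by (simp add: walk_def mult.assoc)
qed

text \<open>Starting at the second color \<open>d\<close>, the first step leads to \<open>c\<close>, and then the walk dies unless the next
  pair \<open>{d, z}\<close> contains \<open>c\<close>. It survives only if the colors alternate; then all factors are equal and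
  commute.\<close>

lemma reversed_start:
  assumes "set (c # d # ds) \<subseteq> C" "distinct_adj (c # d # ds)"
  shows "if alternating (c # d # ds)
    then E {c, d} * word m E (steps (d # ds)) = word m E (steps (d # ds)) * E {c, d}
    else p d * word m E (steps (c # d # ds)) = 0"
  using assms
proof (induction ds arbitrary: c d)
  case Nil
  then show ?case
    using shape_block[of c d] by (simp add: E)
next
  case (Cons z ds)
  then have C: "c \<in> C" "d \<in> C" "z \<in> C" "c \<noteq> d" "d \<noteq> z" by auto
  let ?W = "word m E (steps (d # z # ds))"
  have front: "p d * word m E (steps (c # d # z # ds)) = p d * (X * Y) * (p c * ?W)"
    using p_block(1)[of d c] C E[of c d] block_commute[of c d]
    by (simp add: mult.assoc[symmetric])
  show ?case
  proof (cases "z = c")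
    case False
    have "p c * ?W = p c * block d z * word m E (steps (z # ds))"
      using C E[of d z] by (simp add: mult.assoc)
    then have "p c * ?W = 0" using p_block_other[of d z c] C False by auto
    then show ?thesis using False front by simp
  next
    case True
    have IH: "if alternating (d # c # ds)
      then E {d, c} * word m E (steps (c # ds)) = word m E (steps (c # ds)) * E {d, c}
      else p c * word m E (steps (d # c # ds)) = 0"
      using Cons True by (intro Cons.IH) auto
    show ?thesis
    proof (cases "alternating (d # c # ds)")
      case True
      then have comm: "E {c, d} * word m E (steps (c # ds)) = word m E (steps (c # ds)) * E {c, d}"
        using IH by (simp add: insert_commute)
      show ?thesis
        using True \<open>z = c\<close> by (simp add: insert_commute mult.assoc comm mult_extend_right[OF comm])
    next
      case False
      then show ?thesis using IH \<open>z = c\<close> front by simp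
    qed
  qed
qed

text \<open>The first factor \<open>E {c, d}\<close> is the sum of its parts starting at \<open>c\<close> and at \<open>d\<close>. The first part has the
  trace of the walk. The second vanishes, or, for alternating colors, it has the same trace because
  \<open>p d * E {c, d} = E {c, d} * p c\<close> and \<open>E {c, d}\<close> commutes with the remaining factors.\<close>

lemma trace_E_word:
  assumes "set (c # ds) \<subseteq> C" "distinct_adj (c # ds @ [c])"
  shows "trace (word m E (steps (c # ds @ [c]))) =
    (if alternating (c # ds @ [c]) then 2 else 1) * trace (walk (c # ds))"
proof -
  obtain d ds' where ds: "ds = d # ds'" using assms by (cases ds) auto
  have C: "c \<in> C" "d \<in> C" "c \<noteq> d" using assms ds by auto
  let ?R = "word m E (steps (d # ds' @ [c]))" and ?e = "E {c, d}"
  have W: "word m E (steps (c # ds @ [c])) = ?e * ?R" by (simp add: ds)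
  have e: "?e = block c d" using E C by blast
  have split: "?e = p c * ?e + p d * ?e"
    unfolding e using p_block(1)[of c d] p_block(1)[of d c] C
    by (simp add: block_commute[of d c]) (simp add: block_def)
  have "trace (p c * (?e * ?R)) = trace (walk (c # ds))"
    using p_E_word[of "c # ds" c] assms trace_walk_p[of c ds] W by simp
  moreover have "trace (p d * (?e * ?R)) =
      (if alternating (c # ds @ [c]) then trace (p c * (?e * ?R)) else 0)"
  proof -
    have rs: "if alternating (c # d # ds' @ [c])
      then ?e * ?R = ?R * ?e else p d * word m E (steps (c # d # ds' @ [c])) = 0"
      using assms ds by (intro reversed_start) auto
    show ?thesis
    proof (cases "alternating (c # ds @ [c])")
      case True
      then have comm: "?e * ?R = ?R * ?e" using rs ds by simp
      have "p d * ?e = ?e * p c"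
        unfolding e using p_block(1)[of d c] p_block(2)[of d c] C block_commute[of c d] by simp
      then have "trace (p d * (?e * ?R)) = trace (?e * (p c * ?R))"
        by (simp add: mult.assoc[symmetric])
      also have "\<dots> = trace (p c * (?R * ?e))" by (simp only: trace_comm[of ?e] mult.assoc)
      finally show ?thesis using True comm by simp
    next
      case False
      then show ?thesis using rs ds W by simp
    qed
  qed
  moreover have "trace (?e * ?R) = trace (p c * (?e * ?R)) + trace (p d * (?e * ?R))"
    using arg_cong[OF split, of "\<lambda>M. trace (M * ?R)"]
    by (simp add: distrib_right trace_add mult.assoc)
  ultimately show ?thesis unfolding W by simp
qed

end

lemma set_steps:
  "distinct_adj cs \<Longrightarrow> set cs \<subseteq> C \<Longrightarrow> set (steps cs) \<subseteq> {{c, d} | c d. c \<in> C \<and> d \<in> C \<and> c \<noteq> d}"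
  by (induction cs rule: steps.induct) auto

context colored_factorization_pair
begin

lemma lift_block:
  assumes "c \<in> C" "d \<in> C" and W: "X * Y * lift T = lift T * (X' * Y')"
  shows "G.block c d * lift T = lift T * G'.block c d"
proof -
  have "p x * (X * Y) * p y * lift T = lift T * (p x * (X' * Y') * p y)" if "x \<in> C" "y \<in> C" for x y
  proof -
    have "p x * (X * Y) * p y * lift T = p x * (X * Y * lift T) * p y"
      by (simp only: mult.assoc lift_commutes_p[OF that(2)])
    also have "\<dots> = lift T * p x * (X' * Y') * p y"
      by (simp only: W mult.assoc[symmetric] lift_commutes_p[OF that(1)])
    finally show ?thesis by (simp only: mult.assoc)
  qed
  then show ?thesis
    using assms(1,2) by (simp add: G.block_def G'.block_def distrib_left distrib_right)
qed

lemma trace_b_words_from_walks: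
  assumes walks: "\<And>c ds. set (c # ds) \<subseteq> C \<Longrightarrow> distinct_adj (c # ds @ [c]) \<Longrightarrow>
      trace (G.walk (c # ds)) = trace (G'.walk (c # ds))"
    and cs: "set cs \<subseteq> C"
  shows "trace (word n G.b cs) = trace (word n G'.b cs)"
proof (rule trace_words_by_cyclic_reduction[of C _ _ _ 2, OF _ _ _ _ _ _ cs])
  fix c assume c: "c \<in> C"
  show "shape n n (G.b c)" "shape n n (G'.b c)" using c G.shape_b G'.shape_b by auto
  show "G.b c * G.b c = 2 *\<^sub>R G.b c" "G'.b c * G'.b c = 2 *\<^sub>R G'.b c"
    using c G.b_b G'.b_b by auto
  have "trace (Y * p c * X) = trace (p c * (X * Y) * p c)"
    "trace (Y' * p c * X') = trace (p c * (X' * Y') * p c)"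
    using G.p_idem[OF c]
    by (metis mult.assoc trace_comm)+
  then show "trace (G.b c) = trace (G'.b c)"
    unfolding G.b_def G'.b_def using G.p_XY_p[OF c] G'.p_XY_p[OF c] by simp
next
  fix c ds assume "set (c # ds) \<subseteq> C" "distinct_adj (c # ds @ [c])"
  then show "trace (word n G.b (c # ds)) = trace (word n G'.b (c # ds))"
    using walks G.trace_b_word G'.trace_b_word by metis
qed

lemma trace_b_words_from_vc_words:
  assumes "\<And>cs. set cs \<subseteq> C \<Longrightarrow> trace (word m G.vc cs) = trace (word m G'.vc cs)"
    and "set cs \<subseteq> C"
  shows "trace (word n G.b cs) = trace (word n G'.b cs)"
  using assms(1) G.trace_walk_vc_word G'.trace_walk_vc_word
  by (intro trace_b_words_from_walks[OF _ assms(2)]) metis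

lemma trace_b_words_from_pair_words:
  assumes E: "\<And>c d. c \<in> C \<Longrightarrow> d \<in> C \<Longrightarrow> c \<noteq> d \<Longrightarrow> E {c, d} = G.block c d"
    "\<And>c d. c \<in> C \<Longrightarrow> d \<in> C \<Longrightarrow> c \<noteq> d \<Longrightarrow> E' {c, d} = G'.block c d"
    and tr: "\<And>ps. set ps \<subseteq> {{c, d} | c d. c \<in> C \<and> d \<in> C \<and> c \<noteq> d} \<Longrightarrow>
      trace (word m E ps) = trace (word m E' ps)"
    and "set cs \<subseteq> C"
  shows "trace (word n G.b cs) = trace (word n G'.b cs)"
proof (rule trace_b_words_from_walks[OF _ assms(4)])
  interpret E: colored_pair_matrices C n m p X Y E by unfold_locales (rule E(1))
  interpret E': colored_pair_matrices C n m p X' Y' E' by unfold_locales (rule E(2))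
  fix c ds assume *: "set (c # ds) \<subseteq> C" "distinct_adj (c # ds @ [c])"
  have "set (steps (c # ds @ [c])) \<subseteq> {{c, d} | c d. c \<in> C \<and> d \<in> C \<and> c \<noteq> d}"
    using * by (intro set_steps) auto
  from tr[OF this] show "trace (G.walk (c # ds)) = trace (G'.walk (c # ds))"
    unfolding E.trace_E_word[OF *] E'.trace_E_word[OF *] by (auto split: if_splits)
qed

end

section \<open>Matrices that preserve colors\<close>

lemma sorted_eq_concat_filter:
  fixes xs :: "nat list"
  assumes "sorted xs" "set xs \<subseteq> {a..<b}"
  shows "xs = concat (map (\<lambda>c. filter ((=) c) xs) [a..<b])"
  using assms
proof (induction xs)
  case Nil
  then show ?case by (simp add: concat_eq_Nil_conv[symmetric])
next
  case (Cons x xs)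
  then have x: "a \<le> x" "x < b" "\<And>y. y \<in> set xs \<Longrightarrow> x \<le> y" by auto
  then have split: "[a..<b] = [a..<x] @ x # [Suc x..<b]"
    by (metis le_eq_less_or_eq upt_add_eq_append upt_conv_Cons le_add_diff_inverse)
  have none: "filter ((=) c) xs = []" if "c < x" for c
    using x(3) that by (fastforce simp: filter_empty_conv)
  have "xs = concat (map (\<lambda>c. filter ((=) c) xs) [a..<b])" using Cons by auto
  also have "\<dots> = filter ((=) x) xs @ concat (map (\<lambda>c. filter ((=) c) xs) [Suc x..<b])"
    unfolding split by (simp add: none)
  finally have "x # xs = (x # filter ((=) x) xs) @ concat (map (\<lambda>c. filter ((=) c) xs) [Suc x..<b])"
    by simp
  also have "\<dots> = concat (map (\<lambda>c. filter ((=) c) (x # xs)) [a..<b])"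
  proof -
    have "map (\<lambda>c. filter ((=) c) (x # xs)) [a..<x] = map (\<lambda>c. []) [a..<x]"
      by (rule map_cong) (auto simp: none)
    moreover have "map (\<lambda>c. filter ((=) c) (x # xs)) [Suc x..<b] = map (\<lambda>c. filter ((=) c) xs) [Suc x..<b]"
      by (rule map_cong) auto
    ultimately show ?thesis
      by (simp only: split map_append list.map concat_append concat.simps) simp
  qed
  finally show ?case .
qed

text \<open>When the indices are listed color by color, a matrix without entries between different colors is
  a direct sum. The induction splits off the block of the first color.\<close>

lemma color_preserving_imp_diag_block_mat:
  fixes T :: "'a :: zero mat"
  assumes "distinct cs" "T \<in> carrier_mat N N" "length cl = N"
    and "cl = concat (map (\<lambda>c. replicate (q c) c) cs)"
    and "\<And>i j. i < N \<Longrightarrow> j < N \<Longrightarrow> cl ! i \<noteq> cl ! j \<Longrightarrow> T $$ (i, j) = 0"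
  shows "\<exists>Bs. T = diag_block_mat Bs \<and> (\<forall>B\<in>set Bs. square_mat B) \<and> map dim_row Bs = map q cs"
  using assms
proof (induction cs arbitrary: cl T N)
  case Nil
  then show ?case by (intro exI[of _ "[]"]) (auto intro!: eq_matI)
next
  case (Cons c cs)
  let ?r = "concat (map (\<lambda>c. replicate (q c) c) cs)"
  let ?A = "mat (q c) (q c) (\<lambda>(i, j). T $$ (i, j))"
  let ?D = "mat (length ?r) (length ?r) (\<lambda>(i, j). T $$ (i + q c, j + q c))"
  have cl: "cl = replicate (q c) c @ ?r" and N: "N = q c + length ?r" using Cons.prems by auto
  have c: "c \<notin> set ?r" using Cons.prems(1) by auto
  have "\<exists>Bs. ?D = diag_block_mat Bs \<and> (\<forall>B\<in>set Bs. square_mat B) \<and> map dim_row Bs = map q cs"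
  proof (rule Cons.IH[where cl = ?r and N = "length ?r"])
    fix i j assume "i < length ?r" "j < length ?r" "?r ! i \<noteq> ?r ! j"
    then show "?D $$ (i, j) = 0"
      using Cons.prems(5)[of "i + q c" "j + q c"] by (simp add: cl N nth_append)
  qed (use Cons.prems in auto)
  then obtain Bs where Bs: "?D = diag_block_mat Bs" "\<forall>B\<in>set Bs. square_mat B"
    "map dim_row Bs = map q cs" by blast
  have "T $$ (i, j) = 0" if "i < q c" "\<not> j < q c" "j < N" for i j
  proof -
    have "?r ! (j - q c) \<in> set ?r" using that N by (intro nth_mem) simp
    then have "cl ! i \<noteq> cl ! j" using that c by (auto simp: cl nth_append)
    then show ?thesis using Cons.prems(5) that by simp
  qed
  moreover have "T $$ (i, j) = 0" if "\<not> i < q c" "j < q c" "i < N" for i j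
  proof -
    have "?r ! (i - q c) \<in> set ?r" using that N by (intro nth_mem) simp
    then have "cl ! i \<noteq> cl ! j" using that c by (auto simp: cl nth_append)
    then show ?thesis using Cons.prems(5) that by simp
  qed
  ultimately have "T = four_block_mat ?A (0\<^sub>m (q c) (length ?r)) (0\<^sub>m (length ?r) (q c)) ?D"
    using Cons.prems(2) N by (intro eq_matI) auto
  also have "\<dots> = diag_block_mat (?A # Bs)" by (simp add: Let_def Bs(1)[symmetric])
  finally show ?case using Bs(2,3) by (intro exI[of _ "?A # Bs"]) auto
qed

definition color_block :: "nat list \<Rightarrow> nat \<Rightarrow> fmat" where
  "color_block cl c = fmat_of (length cl) (length cl) (\<lambda>i j. if i = j \<and> cl ! i = c then 1 else 0)"

lemma entry_color_block_mult:
  "entry (color_block cl c * A) i j = (if i < length cl \<and> cl ! i = c then entry A i j else 0)"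
proof -
  have "shape (length cl) (length cl) (color_block cl c)" by (simp add: color_block_def)
  then have "entry (color_block cl c * A) i j =
      (\<Sum>k<length cl. if k = i then (if cl ! i = c then entry A i j else 0) else 0)"
    unfolding entry_mult[OF \<open>shape _ _ _\<close>]
    by (intro sum.cong) (auto simp: color_block_def entry_fmat_of)
  then show ?thesis by auto
qed

lemma entry_mult_color_block:
  "entry (A * color_block cl c) i j = (if j < length cl \<and> cl ! j = c then entry A i j else 0)"
proof -
  have "shape (length cl) (length cl) (color_block cl c)" by (simp add: color_block_def)
  then have "entry (A * color_block cl c) i j =
      (\<Sum>k<length cl. if k = j then (if cl ! j = c then entry A i j else 0) else 0)"
    unfolding entry_mult'[OF \<open>shape _ _ _\<close>]
    by (intro sum.cong) (auto simp: color_block_def entry_fmat_of)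
  then show ?thesis by auto
qed

lemma trace_color_block: "trace (color_block cl c) = real (length (filter ((=) c) cl))"
proof -
  have "trace (color_block cl c) = (\<Sum>i<length cl. if cl ! i = c then 1 else 0)"
    by (simp add: color_block_def trace_shape[OF shape_fmat_of] entry_fmat_of)
  also have "\<dots> = real (card {i. i < length cl \<and> c = cl ! i})"
    by (simp add: sum.If_cases Int_def eq_commute)
  finally show ?thesis by (simp add: length_filter_conv_card)
qed

section \<open>The incidence matrices of a numbered graph\<close>

text \<open>The number of vertices of an edge, weighted in this way, is always 2.\<close>

definition weight :: "edge \<Rightarrow> real" where
  "weight e = (if is_link e then 1 else 2)"

text \<open>The weight enters on one side only. This reproduces the asymmetry of the line graph, where the
  entry from a loop to an incident link is 2 and the entry back is 1.\<close>

definition inc_out :: "nat \<Rightarrow> colored_edge list \<Rightarrow> fmat" where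
  "inc_out n es = fmat_of (length es) n (\<lambda>i v. if v \<in> ends (snd (es ! i)) then weight (snd (es ! i)) else 0)"

definition inc_in :: "nat \<Rightarrow> colored_edge list \<Rightarrow> fmat" where
  "inc_in n es = fmat_of n (length es) (\<lambda>v i. if v \<in> ends (snd (es ! i)) then 1 else 0)"

lemma ends_loop: "\<not> is_link e \<Longrightarrow> \<exists>v. ends e = {v}"
  by (cases e) auto

lemma adj_carrier [simp]: "adj n G c \<in> carrier_mat n n"
  by (simp add: adj_def)

lemma vc_line_adj_carrier [simp]: "vc_line_adj es c \<in> carrier_mat (length es) (length es)"
  by (simp add: vc_line_adj_def)

lemma ec_line_adj_carrier [simp]: "ec_line_adj es c \<in> carrier_mat (length es) (length es)"
  by (simp add: ec_line_adj_def)

lemma tpose_adj: "tpose (of_mat (adj n G c)) = of_mat (adj n G c)"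
  by (rule fmat_eqI, simp add: entry_of_mat[OF adj_carrier]) (auto simp: adj_def insert_commute)

text \<open>Every entry of a row of the adjacency matrix is determined by the unique edge of that color at the
  vertex. The row is stated in the form that it takes in \<open>b c - idm n\<close>.\<close>

lemma adj_row:
  assumes G: "loop_signed_graph n k G" and c: "c \<in> {1..k}" and v: "v < n"
  shows "\<exists>e. (c, e) \<in> G \<and> v \<in> ends e \<and> edge_on n e \<and> (\<forall>f. (c, f) \<in> G \<longrightarrow> v \<in> ends f \<longrightarrow> f = e) \<and>
    (\<forall>w<n. adj n G c $$ (v, w) = (if is_D_loop e then (if w = v then -1 else 0)
      else (if w \<in> ends e then weight e else 0) - (if w = v then 1 else 0)))"
proof -
  obtain e where e: "(c, e) \<in> G" "v \<in> ends e" and uniq: "\<And>f. (c, f) \<in> G \<Longrightarrow> v \<in> ends f \<Longrightarrow> f = e"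
    using G c v unfolding loop_signed_graph_def by blast
  have on: "edge_on n e" using G e(1) unfolding loop_signed_graph_def by blast
  have iff: "(c, Link {v, w}) \<in> G \<longleftrightarrow> e = Link {v, w}" "(c, N_loop v) \<in> G \<longleftrightarrow> e = N_loop v"
    "(c, D_loop v) \<in> G \<longleftrightarrow> e = D_loop v" for w
    using e uniq by (metis ends.simps insertI1)+
  have "adj n G c $$ (v, w) = (if is_D_loop e then (if w = v then -1 else 0)
      else (if w \<in> ends e then weight e else 0) - (if w = v then 1 else 0))" if w: "w < n" for w
  proof (cases e)
    case (Link S)
    then obtain u where "S = {v, u}" "u \<noteq> v"
      using e(2) on by (auto simp: edge_on_def card_2_iff)
    then show ?thesis using Link w v by (auto simp: adj_def iff weight_def doubleton_eq_iff)
  qed (use e(2) w v in \<open>auto simp: adj_def iff weight_def\<close>)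
  then show ?thesis using e on uniq by blast
qed

lemma signed_rows_adj:
  assumes G: "loop_signed_graph n k G" and c: "c \<in> {1..k}"
  shows "signed_rows n (of_mat (adj n G c))"
  unfolding signed_rows_def
proof (intro conjI allI)
  show "shape n n (of_mat (adj n G c))" by (rule shape_of_mat[OF adj_carrier])
  fix v
  show "\<exists>w s. s \<in> {-1, 0, 1} \<and> (\<forall>j. entry (of_mat (adj n G c)) v j = (if j = w then s else 0))"
  proof (cases "v < n")
    case True
    obtain e where e: "v \<in> ends e" "edge_on n e" and row: "\<forall>w<n. adj n G c $$ (v, w) =
      (if is_D_loop e then (if w = v then -1 else 0)
       else (if w \<in> ends e then weight e else 0) - (if w = v then 1 else 0))"
      using adj_row[OF G c True] by blast
    show ?thesis
    proof (cases e)
      case (Link S)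
      then obtain u where "S = {v, u}" "u \<noteq> v" "u < n"
        using e by (auto simp: edge_on_def card_2_iff)
      then show ?thesis using Link True row
        by (intro exI[of _ u] exI[of _ 1]) (auto simp: entry_of_mat[OF adj_carrier] weight_def)
    next
      case (N_loop u)
      then show ?thesis using e True row
        by (intro exI[of _ v] exI[of _ 1]) (auto simp: entry_of_mat[OF adj_carrier] weight_def)
    next
      case (D_loop u)
      then show ?thesis using e True row
        by (intro exI[of _ v] exI[of _ "-1"]) (auto simp: entry_of_mat[OF adj_carrier] weight_def)
    qed
  qed (auto simp: entry_of_mat[OF adj_carrier])
qed

locale numbered_graph =
  fixes n k :: nat and G :: colored_graph and es :: "colored_edge list"
  assumes graph: "loop_signed_graph n k G" and numbering: "edge_numbering G es"
begin

lemma nth_edge: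
  assumes "i < length es"
  shows "fst (es ! i) \<in> {1..k}" "es ! i \<in> G" "\<not> is_D_loop (snd (es ! i))" "edge_on n (snd (es ! i))"
    "ends (snd (es ! i)) \<subseteq> {..<n}" "finite (ends (snd (es ! i)))"
    "weight (snd (es ! i)) * real (card (ends (snd (es ! i)))) = 2"
proof -
  have "es ! i \<in> set es" using assms by simp
  then have G: "es ! i \<in> G" and D: "\<not> is_D_loop (snd (es ! i))"
    using numbering by (auto simp: edge_numbering_def split: prod.splits)
  then show "es ! i \<in> G" "\<not> is_D_loop (snd (es ! i))" by auto
  show c: "fst (es ! i) \<in> {1..k}" and on: "edge_on n (snd (es ! i))"
    using graph G by (auto simp: loop_signed_graph_def)
  then show sub: "ends (snd (es ! i)) \<subseteq> {..<n}" by (simp add: edge_on_def)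
  then show "finite (ends (snd (es ! i)))" by (rule finite_subset) simp
  show "weight (snd (es ! i)) * real (card (ends (snd (es ! i)))) = 2"
    using on ends_loop[of "snd (es ! i)"] by (auto simp: weight_def edge_on_def)
qed

lemma same_color_disjoint:
  assumes "i < length es" "j < length es" "fst (es ! i) = fst (es ! j)" "i \<noteq> j"
  shows "ends (snd (es ! i)) \<inter> ends (snd (es ! j)) = {}"
proof (rule ccontr)
  assume "\<not> ?thesis"
  then obtain v where v: "v \<in> ends (snd (es ! i))" "v \<in> ends (snd (es ! j))" by blast
  then have "v < n" using nth_edge(5)[OF assms(1)] by auto
  then have "\<exists>!e. (fst (es ! i), e) \<in> G \<and> v \<in> ends e"
    using graph nth_edge(1)[OF assms(1)] by (simp add: loop_signed_graph_def)
  moreover have "(fst (es ! i), snd (es ! i)) \<in> G" using nth_edge(2)[OF assms(1)] by simp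
  moreover have "(fst (es ! i), snd (es ! j)) \<in> G"
    unfolding assms(3) using nth_edge(2)[OF assms(2)] by simp
  ultimately have "snd (es ! i) = snd (es ! j)" using v by blast
  then have "es ! i = es ! j" using assms(3) by (simp add: prod_eq_iff)
  then show False using assms numbering by (simp add: edge_numbering_def nth_eq_iff_index_eq)
qed

definition "X = inc_out n es"
definition "Y = inc_in n es"
definition "p = color_block (map fst es)"

lemma shape_X: "shape (length es) n X" and shape_Y: "shape n (length es) Y"
  by (simp_all add: X_def Y_def inc_out_def inc_in_def)

lemma entry_p_mult: "entry (p c * A) i j = (if i < length es \<and> fst (es ! i) = c then entry A i j else 0)"
  and entry_mult_p: "entry (A * p c) i j = (if j < length es \<and> fst (es ! j) = c then entry A i j else 0)"
  by (auto simp: p_def entry_color_block_mult entry_mult_color_block)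

lemma entry_XY:
  assumes "i < length es" "j < length es"
  shows "entry (X * Y) i j =
    weight (snd (es ! i)) * real (card (ends (snd (es ! i)) \<inter> ends (snd (es ! j))))"
proof -
  let ?I = "ends (snd (es ! i)) \<inter> ends (snd (es ! j))"
  have "entry (X * Y) i j = (\<Sum>v<n. if v \<in> ?I then weight (snd (es ! i)) else 0)"
    unfolding entry_mult[OF shape_X] using assms
    by (intro sum.cong) (auto simp: X_def Y_def inc_out_def inc_in_def entry_fmat_of)
  also have "\<dots> = (\<Sum>v\<in>?I. weight (snd (es ! i)))"
    using nth_edge(5)[OF assms(1)] by (intro sum.mono_neutral_cong_right) auto
  finally show ?thesis by simp
qed

lemma entry_XY_same_color:
  assumes "i < length es" "j < length es" "fst (es ! i) = fst (es ! j)"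
  shows "entry (X * Y) i j = (if i = j then 2 else 0)"
  using nth_edge(7)[OF assms(2)] same_color_disjoint[OF assms]
  by (cases "i = j") (simp_all add: entry_XY assms)

lemma factorization: "colored_factorization {1..k} n (length es) p X Y"
proof
  show "shape (length es) n X" "shape n (length es) Y" by (rule shape_X, rule shape_Y)
  show "shape (length es) (length es) (p c)" for c by (simp add: p_def color_block_def)
  have p_entry: "entry (p c) i j = (if i < length es \<and> i = j \<and> fst (es ! i) = c then 1 else 0)" for c i j
    by (auto simp: p_def color_block_def entry_fmat_of)
  show "p c * p c = p c" for c
    by (rule fmat_eqI) (auto simp: entry_p_mult p_entry)
  show "p c * p d = 0" if "c \<noteq> d" for c d
    using that by (intro fmat_eqI) (auto simp: entry_p_mult p_entry)
  show "(\<Sum>c\<in>{1..k}. p c) = idm (length es)"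
  proof (rule fmat_eqI)
    fix i j
    show "entry (\<Sum>c\<in>{1..k}. p c) i j = entry (idm (length es)) i j"
      using nth_edge(1)[of i] by (cases "i < length es \<and> i = j") (auto simp: p_entry entry_idm)
  qed
  show "p c * (X * Y) * p c = 2 *\<^sub>R p c" for c
  proof (rule fmat_eqI)
    fix i j
    show "entry (p c * (X * Y) * p c) i j = entry (2 *\<^sub>R p c) i j"
      using entry_XY_same_color[of i j] unfolding entry_mult_p entry_p_mult
      by (auto simp: p_entry)
  qed
qed simp

sublocale colored_factorization "{1..k}" n "length es" p X Y
  by (rule factorization)

text \<open>In the sum over edges, only the unique edge of color \<open>c\<close> at \<open>v\<close> contributes, and it is missing from the
  numbering exactly when it is a D-loop.\<close>

lemma b_eq_adj:
  assumes c: "c \<in> {1..k}"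
  shows "b c = idm n + of_mat (adj n G c)"
proof (rule fmat_eqI)
  fix v w
  have sh: "shape n n (b c)" by (rule shape_b[OF c])
  show "entry (b c) v w = entry (idm n + of_mat (adj n G c)) v w"
  proof (cases "v < n \<and> w < n")
    case True
    then have v: "v < n" and w: "w < n" by auto
    obtain e where e: "(c, e) \<in> G" "v \<in> ends e" "edge_on n e"
      and uniq: "\<forall>f. (c, f) \<in> G \<longrightarrow> v \<in> ends f \<longrightarrow> f = e"
      and row: "\<forall>w<n. adj n G c $$ (v, w) =
      (if is_D_loop e then (if w = v then -1 else 0)
       else (if w \<in> ends e then weight e else 0) - (if w = v then 1 else 0))"
      using adj_row[OF graph c v] by blast
    have "entry (b c) v w = (\<Sum>i<length es. entry Y v i * entry (p c * X) i w)"
      unfolding b_def mult.assoc by (rule entry_mult[OF shape_Y])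
    also have "\<dots> = (\<Sum>i<length es. if es ! i = (c, e) \<and> w \<in> ends e then weight e else 0)"
    proof (rule sum.cong)
      fix i assume "i \<in> {..<length es}"
      then have i: "i < length es" by simp
      have "v \<in> ends (snd (es ! i)) \<and> fst (es ! i) = c \<longleftrightarrow> es ! i = (c, e)"
        using nth_edge(2)[OF i] uniq e(2) by (metis prod.collapse fst_conv snd_conv)
      then show "entry Y v i * entry (p c * X) i w =
          (if es ! i = (c, e) \<and> w \<in> ends e then weight e else 0)"
        using i v w
        by (cases "es ! i = (c, e)")
          (auto simp: entry_p_mult X_def Y_def inc_out_def inc_in_def entry_fmat_of)
    qed simp
    also have "\<dots> = (if \<not> is_D_loop e \<and> w \<in> ends e then weight e else 0)"
    proof (cases "is_D_loop e")
      case True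
      then have "es ! i \<noteq> (c, e)" if "i < length es" for i
        using nth_edge(3)[OF that] by auto
      then show ?thesis using True by simp
    next
      case False
      then have "(c, e) \<in> set es" using e numbering by (simp add: edge_numbering_def)
      then obtain i0 where i0: "i0 < length es" "es ! i0 = (c, e)" by (auto simp: in_set_conv_nth)
      then have "es ! i = (c, e) \<longleftrightarrow> i = i0" if "i < length es" for i
        using that numbering by (metis edge_numbering_def nth_eq_iff_index_eq)
      then have "(\<Sum>i<length es. if es ! i = (c, e) \<and> w \<in> ends e then weight e else 0) =
          (\<Sum>i<length es. if i = i0 then (if w \<in> ends e then weight e else 0) else 0)"
        by (intro sum.cong) auto
      then show ?thesis using False i0 by simp
    qed
    finally show ?thesis using row[rule_format, OF w] v w e(2)
      by (cases e) (auto simp: entry_idm entry_of_mat[OF adj_carrier])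
  next
    case False
    then show ?thesis using shapeD[OF sh] by (auto simp: entry_idm entry_of_mat[OF adj_carrier])
  qed
qed

text \<open>By \<open>b_b\<close>, \<open>b c\<close> is twice a projection, and a projection \<open>P\<close> gives the involution \<open>2 P - I\<close>.\<close>

lemma adj_involution:
  assumes c: "c \<in> {1..k}"
  shows "of_mat (adj n G c) * of_mat (adj n G c) = idm n"
proof -
  have sh: "shape n n (of_mat (adj n G c))" by (rule shape_of_mat[OF adj_carrier])
  have "of_mat (adj n G c) = b c - idm n" by (simp add: b_eq_adj[OF c])
  then have "of_mat (adj n G c) * of_mat (adj n G c) = (b c - idm n) * (b c - idm n)" by simp
  also have "\<dots> = idm n"
    using b_b[OF c] idm_mult[OF shape_b[OF c]] mult_idm[OF shape_b[OF c]] idm_mult[OF shape_idm]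
    by (simp add: left_diff_distrib right_diff_distrib scaleR_2)
  finally show ?thesis .
qed

text \<open>The trace of \<open>Y p\<^sub>c X\<close> is that of \<open>p\<^sub>c X Y p\<^sub>c = 2 p\<^sub>c\<close>, so half of it is the size of the color class.\<close>

lemma half_trace_adj:
  assumes c: "c \<in> {1..k}"
  shows "mat_trace (1\<^sub>m n + adj n G c) / 2 = real (length (filter ((=) c) (map fst es)))"
proof -
  have "mat_trace (1\<^sub>m n + adj n G c) = trace (b c)"
    by (simp add: mat_trace_eq_trace[of _ n] of_mat_add[of _ n n] b_eq_adj[OF c])
  also have "\<dots> = trace (p c * (X * Y))"
    by (simp only: b_def mult.assoc trace_comm[of Y])
  also have "\<dots> = trace (p c * (X * Y) * p c)"
    unfolding trace_comm[of "p c * (X * Y)" "p c"] by (simp add: mult.assoc[symmetric] p_idem[OF c])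
  finally show ?thesis
    unfolding p_XY_p[OF c] by (simp add: trace_scaleR p_def trace_color_block)
qed

lemma vc_eq_vc_line_adj: "of_mat (vc_line_adj es c) = vc c"
proof (rule fmat_eqI)
  fix i j
  show "entry (of_mat (vc_line_adj es c)) i j = entry (vc c) i j"
  proof (cases "i < length es \<and> j < length es")
    case True
    then have i: "i < length es" and j: "j < length es" by auto
    let ?e = "snd (es ! i)" and ?f = "snd (es ! j)"
    have W: "entry (X * Y) i j = weight ?e * real (card (ends ?e \<inter> ends ?f))"
      by (rule entry_XY[OF i j])
    have lhs: "entry (of_mat (vc_line_adj es c)) i j =
      (if i \<noteq> j \<and> fst (es ! i) = c \<and> ends ?e \<subseteq> ends ?f then 2
       else if i \<noteq> j \<and> fst (es ! i) = c \<and> is_link ?e \<and> card (ends ?e \<inter> ends ?f) = 1 then 1 else 0)"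
      unfolding entry_of_mat[OF vc_line_adj_carrier]
      using i j by (simp add: vc_line_adj_def case_prod_beta)
    have rhs: "entry (vc c) i j = (if fst (es ! i) = c then entry (X * Y) i j - (if i = j then 2 else 0) else 0)"
      using i by (simp add: vc_def entry_p_mult entry_idm)
    show ?thesis
    proof (cases "i = j")
      case True
      then show ?thesis using lhs rhs entry_XY_same_color[OF i i] by simp
    next
      case ne: False
      show ?thesis
      proof (cases "ends ?e \<subseteq> ends ?f")
        case True
        then show ?thesis using lhs rhs ne W nth_edge(7)[OF i] by (simp add: Int_absorb2)
      next
        case False
        have "card (ends ?e \<inter> ends ?f) < card (ends ?e)"
          using False nth_edge(6)[OF i] by (intro psubset_card_mono) auto
        then have "is_link ?e \<and> card (ends ?e \<inter> ends ?f) \<in> {0, 1} \<or>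
            \<not> is_link ?e \<and> card (ends ?e \<inter> ends ?f) = 0"
          using nth_edge(4)[OF i] ends_loop[of ?e] by (cases "is_link ?e") (auto simp: edge_on_def)
        then show ?thesis using lhs rhs ne W False by (auto simp: weight_def)
      qed
    qed
  next
    case False
    have "shape (length es) (length es) (p c)" by (simp add: p_def color_block_def)
    then have "shape (length es) (length es) (vc c)"
      unfolding vc_def using shape_XY by blast
    then show ?thesis
      using shapeD False shapeD[OF shape_of_mat[OF vc_line_adj_carrier]] by metis
  qed
qed

lemma block_eq_ec_line_adj:
  assumes "c \<noteq> d"
  shows "of_mat (ec_line_adj es {c, d}) = block c d"
proof (rule fmat_eqI)
  fix i j
  have blk: "entry (block c d) i j =
    (if i < length es \<and> j < length es \<and> fst (es ! i) = c \<and> fst (es ! j) = d then entry (X * Y) i j else 0)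
    + (if i < length es \<and> j < length es \<and> fst (es ! i) = d \<and> fst (es ! j) = c then entry (X * Y) i j else 0)"
    unfolding block_def entry_add entry_mult_p entry_p_mult if_if_eq_conj by (simp add: conj_ac)
  show "entry (of_mat (ec_line_adj es {c, d})) i j = entry (block c d) i j"
  proof (cases "i < length es \<and> j < length es")
    case True
    then have i: "i < length es" and j: "j < length es" by auto
    have vc: "vc_line_adj es x $$ (i, j) =
      (if fst (es ! i) = x then entry (X * Y) i j - (if i = j then 2 else 0) else 0)" for x
    proof -
      have "vc_line_adj es x $$ (i, j) = entry (vc x) i j"
        using i j by (simp add: vc_eq_vc_line_adj[symmetric] entry_of_mat[OF vc_line_adj_carrier])
      then show ?thesis using i by (simp add: vc_def entry_p_mult entry_idm)
    qed
    have "entry (of_mat (ec_line_adj es {c, d})) i j =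
      (if {fst (es ! i), fst (es ! j)} = {c, d} then vc_line_adj es c $$ (i, j) + vc_line_adj es d $$ (i, j) else 0)"
      unfolding entry_of_mat[OF ec_line_adj_carrier]
      using i j assms by (simp add: ec_line_adj_def)
    moreover consider "fst (es ! i) = c" "fst (es ! j) = d" | "fst (es ! i) = d" "fst (es ! j) = c"
      | "{fst (es ! i), fst (es ! j)} \<noteq> {c, d}"
      by (auto simp: doubleton_eq_iff)
    then have "entry (block c d) i j =
      (if {fst (es ! i), fst (es ! j)} = {c, d} then vc_line_adj es c $$ (i, j) + vc_line_adj es d $$ (i, j) else 0)"
    proof cases
      case 1
      then have "i \<noteq> j" using assms by auto
      then show ?thesis unfolding blk vc using i j assms 1 by simp
    next
      case 2
      then have "i \<noteq> j" using assms by auto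
      then show ?thesis unfolding blk vc using i j assms 2 by (simp add: insert_commute)
    next
      case 3
      then have "\<not> (i < length es \<and> j < length es \<and> fst (es ! i) = c \<and> fst (es ! j) = d)"
        "\<not> (i < length es \<and> j < length es \<and> fst (es ! i) = d \<and> fst (es ! j) = c)"
        by blast+
      then show ?thesis unfolding blk by (simp only: if_not_P 3 if_False add_0)
    qed
    ultimately show ?thesis by simp
  next
    case False
    then have "\<not> (i < length es \<and> j < length es \<and> fst (es ! i) = c \<and> fst (es ! j) = d)"
      "\<not> (i < length es \<and> j < length es \<and> fst (es ! i) = d \<and> fst (es ! j) = c)"
      by blast+
    then show ?thesis
      unfolding blk entry_of_mat[OF ec_line_adj_carrier] by (simp only: if_not_P False if_False add_0)
  qed
qed

text \<open>Together with \<open>half_trace_adj\<close>, this makes the color list of a numbering a function of the traces, so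
  two graphs with equal traces have the same projections \<open>p\<close>.\<close>

lemma colors_sorted: "map fst es = concat (map (\<lambda>c. replicate (length (filter ((=) c) (map fst es))) c) [1..<Suc k])"
proof -
  have "set (map fst es) \<subseteq> {1..<Suc k}"
    using nth_edge(1) by (fastforce simp: in_set_conv_nth)
  then show ?thesis
    using numbering sorted_eq_concat_filter[of "map fst es" 1 "Suc k"]
    by (simp only: edge_numbering_def replicate_length_filter)
qed

end

lemma ec_colors_eq: "ec_colors k = {{c, d} | c d. c \<in> {1..k} \<and> d \<in> {1..k} \<and> c \<noteq> d}"
  (is "_ = ?R")
proof
  show "ec_colors k \<subseteq> ?R" unfolding ec_colors_def by fastforce
  show "?R \<subseteq> ec_colors k"
  proof
    fix s assume "s \<in> ?R"
    then obtain c d where s: "s = {c, d}" "c \<in> {1..k}" "d \<in> {1..k}" "c \<noteq> d" by blast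
    then have "s = {min c d, max c d} \<and> 1 \<le> min c d \<and> min c d < max c d \<and> max c d \<le> k"
      by (auto simp: min_def max_def)
    then show "s \<in> ec_colors k" unfolding ec_colors_def by blast
  qed
qed

section \<open>Transplantability and cycle equivalence of line graphs\<close>

theorem theorem3:
  fixes n k :: nat and G G' :: colored_graph and es es' :: "colored_edge list"
  assumes "loop_signed_graph n k G" and "loop_signed_graph n k G'"
    and "\<And>c. c \<in> {1..k} \<Longrightarrow> mat_trace (adj n G c) = mat_trace (adj n G' c)"
    and "edge_numbering G es" and "edge_numbering G' es'"
  shows
    "let nL = length es;
         P1 = transplantable n {1..k} (adj n G) (adj n G');
         P2 = cycle_equivalent n {1..k} (adj n G) (adj n G');
         P3 = transplantable nL {1..k} (vc_line_adj es) (vc_line_adj es');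
         P4 = cycle_equivalent nL {1..k} (vc_line_adj es) (vc_line_adj es');
         P5 = transplantable nL (ec_colors k) (ec_line_adj es) (ec_line_adj es');
         P6 = cycle_equivalent nL (ec_colors k) (ec_line_adj es) (ec_line_adj es')
     in ((P1 \<longleftrightarrow> P2) \<and> (P2 \<longleftrightarrow> P3) \<and> (P3 \<longleftrightarrow> P4) \<and> (P4 \<longleftrightarrow> P5) \<and> (P5 \<longleftrightarrow> P6)) \<and>
        (P1 \<or> P2 \<or> P3 \<or> P4 \<or> P5 \<or> P6 \<longrightarrow>
          (\<exists>T Bs. transplantation_matrix nL {1..k} (vc_line_adj es) (vc_line_adj es') T \<and>
             transplantation_matrix nL (ec_colors k) (ec_line_adj es) (ec_line_adj es') T \<and>
             T = diag_block_mat Bs \<and> (\<forall>B\<in>set Bs. square_mat B) \<and>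
             map (\<lambda>B. real (dim_row B)) Bs =
               map (\<lambda>c. mat_trace (1\<^sub>m n + adj n G c) / 2) [1..<Suc k]))"
proof -
  interpret N: numbered_graph n k G es using assms by unfold_locales
  interpret N': numbered_graph n k G' es' using assms by unfold_locales
  let ?C = "{1..k}" and ?nL = "length es"
  define m where "m = length es"
  have counts: "length (filter ((=) c) (map fst es)) = length (filter ((=) c) (map fst es'))"
    if c: "c \<in> ?C" for c
  proof -
    have "mat_trace (1\<^sub>m n + adj n H c) = real n + mat_trace (adj n H c)" for H
      by (simp add: mat_trace_eq_trace[of _ n] of_mat_add[of _ n n] trace_add)
    then show ?thesis
      using N.half_trace_adj[OF c] N'.half_trace_adj[OF c] assms(3)[OF c] by simp
  qed
  have colors: "map fst es = map fst es'"
  proof -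
    have "map fst es = concat (map (\<lambda>c. replicate (length (filter ((=) c) (map fst es))) c) [1..<Suc k])"
      by (rule N.colors_sorted)
    also have "\<dots> = concat (map (\<lambda>c. replicate (length (filter ((=) c) (map fst es'))) c) [1..<Suc k])"
      using counts by (intro arg_cong[of _ _ concat] map_cong) (auto simp del: upt_Suc)
    also have "\<dots> = map fst es'" by (rule N'.colors_sorted[symmetric])
    finally show ?thesis .
  qed
  then have len: "length es' = m" unfolding m_def by (metis length_map)
  have p: "N'.p = N.p" by (simp add: N.p_def N'.p_def colors)
  interpret L: colored_factorization_pair ?C n m N.p N.X N.Y N'.X N'.Y
    using N.factorization N'.factorization
    by (simp add: colored_factorization_pair_def len p m_def)
  define P1 where "P1 = transplantable n {1..k} (adj n G) (adj n G')"
  define P2 where "P2 = cycle_equivalent n {1..k} (adj n G) (adj n G')"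
  define P3 where "P3 = transplantable m {1..k} (vc_line_adj es) (vc_line_adj es')"
  define P4 where "P4 = cycle_equivalent m {1..k} (vc_line_adj es) (vc_line_adj es')"
  define P5 where "P5 = transplantable m (ec_colors k) (ec_line_adj es) (ec_line_adj es')"
  define P6 where "P6 = cycle_equivalent m (ec_colors k) (ec_line_adj es) (ec_line_adj es')"
  define Q where "Q = (\<exists>T Bs. transplantation_matrix m {1..k} (vc_line_adj es) (vc_line_adj es') T \<and>
             transplantation_matrix m (ec_colors k) (ec_line_adj es) (ec_line_adj es') T \<and>
             T = diag_block_mat Bs \<and> (\<forall>B\<in>set Bs. square_mat B) \<and>
             map (\<lambda>B. real (dim_row B)) Bs =
               map (\<lambda>c. mat_trace (1\<^sub>m n + adj n G c) / 2) [1..<Suc k])"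
  let ?a = "\<lambda>c. of_mat (adj n G c)" and ?a' = "\<lambda>c. of_mat (adj n G' c)"
  have carr: "vc_line_adj es c \<in> carrier_mat m m" "vc_line_adj es' c \<in> carrier_mat m m"
    "ec_line_adj es s \<in> carrier_mat m m" "ec_line_adj es' s \<in> carrier_mat m m" for c s
    using vc_line_adj_carrier[of es] vc_line_adj_carrier[of es'] ec_line_adj_carrier[of es]
      ec_line_adj_carrier[of es'] by (simp_all add: len m_def)
  have b: "L.G.b c = idm n + ?a c" "L.G'.b c = idm n + ?a' c" if "c \<in> ?C" for c
    using N.b_eq_adj[OF that] N'.b_eq_adj[OF that] unfolding p by auto
  have sha: "shape n n (?a c)" "shape n n (?a' c)" for c
    by (rule shape_of_mat[OF adj_carrier])+
  have vc: "of_mat (vc_line_adj es c) = L.G.vc c" "of_mat (vc_line_adj es' c) = L.G'.vc c" for c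
    using N.vc_eq_vc_line_adj N'.vc_eq_vc_line_adj
    by (simp_all add: N.vc_def N'.vc_def L.G.vc_def L.G'.vc_def p m_def len[unfolded m_def])
  have ec: "of_mat (ec_line_adj es {c, d}) = L.G.block c d"
    "of_mat (ec_line_adj es' {c, d}) = L.G'.block c d" if "c \<noteq> d" for c d
    using N.block_eq_ec_line_adj[OF that] N'.block_eq_ec_line_adj[OF that] unfolding p by auto
  have P12: "P1 \<Longrightarrow> P2" and P34: "P3 \<Longrightarrow> P4" and P56: "P5 \<Longrightarrow> P6"
    unfolding P1_def P2_def P3_def P4_def P5_def P6_def by (simp_all add: transplantable_imp_cycle_equivalent carr)
  have adj_words: "P2" if tr: "\<And>cs. set cs \<subseteq> ?C \<Longrightarrow> trace (word n L.G.b cs) = trace (word n L.G'.b cs)"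
  proof -
    have "trace (word n ?a cs) = trace (word n ?a' cs)" if "set cs \<subseteq> ?C" for cs
      by (rule trace_words_add_identity[OF sha(1) sha(2) b(1) b(2) tr that])
    then show ?thesis unfolding P2_def by (subst cycle_equivalent_iff) auto
  qed
  have P21: "P1" if P2
  proof -
    have "\<exists>T S. similar_by n ?C ?a ?a' T S"
    proof (rule signed_involutions_similar)
      fix c assume c: "c \<in> ?C"
      show "signed_rows n (?a c) \<and> tpose (?a c) = ?a c \<and> ?a c * ?a c = idm n"
        using signed_rows_adj[OF assms(1) c] tpose_adj N.adj_involution[OF c] by blast
      show "signed_rows n (?a' c) \<and> tpose (?a' c) = ?a' c \<and> ?a' c * ?a' c = idm n"
        using signed_rows_adj[OF assms(2) c] tpose_adj N'.adj_involution[OF c] by blast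
    next
      fix cs assume "set cs \<subseteq> ?C"
      then show "trace (word n ?a cs) = trace (word n ?a' cs)"
        using that unfolding P2_def by (subst (asm) cycle_equivalent_iff) auto
    qed
    then obtain T S where "similar_by n ?C ?a ?a' T S" by blast
    then show ?thesis
      using similar_imp_transplantation_matrix[of ?C "adj n G" n "adj n G'"]
      unfolding P1_def transplantable_def by auto
  qed
  have P1Q: "Q" if prem: P1
  proof -
    obtain T S where sim: "similar_by n ?C ?a ?a' T S"
      using transplantable_imp_similar[of ?C "adj n G" n "adj n G'"] prem unfolding P1_def by auto
    note T = similar_byD[OF sim]
    have "L.G.b c * T = T * L.G'.b c" if "c \<in> ?C" for c
      using T(1) T(5)[OF that] by (simp add: b[OF that] distrib_left distrib_right)
    then have "similar_by n ?C L.G.b L.G'.b T S" using T by (simp add: similar_by_def)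
    then obtain S' where vcS: "similar_by m ?C L.G.vc L.G'.vc (L.lift T) S'"
      and W: "N.X * N.Y * L.lift T = L.lift T * (N'.X * N'.Y)"
      by (rule L.lift_similar)
    let ?T = "to_mat m m (L.lift T)"
    have tvc: "transplantation_matrix m ?C (vc_line_adj es) (vc_line_adj es') ?T"
      using vcS carr by (intro similar_imp_transplantation_matrix) (simp_all add: vc)
    have "of_mat (ec_line_adj es s) * L.lift T = L.lift T * of_mat (ec_line_adj es' s)"
      if s: "s \<in> ec_colors k" for s
    proof -
      obtain c d where "s = {c, d}" "c \<in> ?C" "d \<in> ?C" "c \<noteq> d"
        using s unfolding ec_colors_eq by blast
      then show ?thesis using L.lift_block[OF _ _ W] ec by simp
    qed
    then have "similar_by m (ec_colors k) (\<lambda>s. of_mat (ec_line_adj es s))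
        (\<lambda>s. of_mat (ec_line_adj es' s)) (L.lift T) S'"
      using similar_byD[OF vcS] by (simp add: similar_by_def)
    then have tec: "transplantation_matrix m (ec_colors k) (ec_line_adj es) (ec_line_adj es') ?T"
      using carr by (intro similar_imp_transplantation_matrix)
    let ?q = "\<lambda>c. length (filter ((=) c) (map fst es))"
    have "\<exists>Bs. ?T = diag_block_mat Bs \<and> (\<forall>B\<in>set Bs. square_mat B) \<and> map dim_row Bs = map ?q [1..<Suc k]"
    proof (rule color_preserving_imp_diag_block_mat)
      show "map fst es = concat (map (\<lambda>c. replicate (?q c) c) [1..<Suc k])" by (rule N.colors_sorted)
      fix i j assume ij: "i < m" "j < m" "map fst es ! i \<noteq> map fst es ! j"
      let ?c = "fst (es ! i)"
      have "?c \<in> ?C" using N.nth_edge(1) ij by (simp add: m_def)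
      have "entry (L.lift T) i j = entry (N.p ?c * L.lift T) i j"
        using ij by (simp add: N.entry_p_mult m_def)
      also have "\<dots> = 0"
        unfolding L.lift_commutes_p[OF \<open>?c \<in> ?C\<close>] using ij by (simp add: N.entry_mult_p m_def)
      finally show "?T $$ (i, j) = 0" using ij by (simp add: to_mat_def)
    qed (simp_all add: m_def)
    then obtain Bs where Bs: "?T = diag_block_mat Bs" "\<forall>B\<in>set Bs. square_mat B"
      "map dim_row Bs = map ?q [1..<Suc k]" by blast
    have "map (\<lambda>B. real (dim_row B)) Bs = map real (map dim_row Bs)" by simp
    also have "\<dots> = map (\<lambda>c. mat_trace (1\<^sub>m n + adj n G c) / 2) [1..<Suc k]"
      unfolding Bs(3) map_map
      by (rule map_cong[OF refl]) (simp only: o_apply N.half_trace_adj set_upt atLeastLessThanSuc_atLeastAtMost)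
    finally show ?thesis unfolding Q_def using tvc tec Bs by blast
  qed
  have Q35: "Q \<Longrightarrow> P3" "Q \<Longrightarrow> P5"
    unfolding Q_def P3_def P5_def transplantable_def by blast+
  have P42: "P2" if P4
  proof (rule adj_words, rule L.trace_b_words_from_vc_words)
    fix cs assume "set cs \<subseteq> ?C"
    then show "trace (word m L.G.vc cs) = trace (word m L.G'.vc cs)"
      using that carr unfolding P4_def by (subst (asm) cycle_equivalent_iff) (auto simp: vc)
  qed
  have P62: "P2" if P6
  proof (rule adj_words, rule L.trace_b_words_from_pair_words)
    show "of_mat (ec_line_adj es {c, d}) = L.G.block c d"
      "of_mat (ec_line_adj es' {c, d}) = L.G'.block c d" if "c \<noteq> d" for c d
      using ec[OF that] by auto
    fix ps assume "set ps \<subseteq> {{c, d} | c d. c \<in> ?C \<and> d \<in> ?C \<and> c \<noteq> d}"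
    then show "trace (word m (\<lambda>s. of_mat (ec_line_adj es s)) ps) =
        trace (word m (\<lambda>s. of_mat (ec_line_adj es' s)) ps)"
      using that carr unfolding P6_def ec_colors_eq by (subst (asm) cycle_equivalent_iff) auto
  qed
  have "((P1 \<longleftrightarrow> P2) \<and> (P2 \<longleftrightarrow> P3) \<and> (P3 \<longleftrightarrow> P4) \<and> (P4 \<longleftrightarrow> P5) \<and> (P5 \<longleftrightarrow> P6)) \<and>
      (P1 \<or> P2 \<or> P3 \<or> P4 \<or> P5 \<or> P6 \<longrightarrow> Q)"
    using P12 P21 P1Q Q35 P34 P56 P42 P62 by blast
  then show ?thesis
    unfolding Let_def P1_def P2_def P3_def P4_def P5_def P6_def Q_def m_def .
qed

end
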